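(* Let $\gamma$ be the standard Gaussian measure on $\mathbb{R}^n$, $\gamma(dx)=(2\pi)^{-n/2}e^{-|x|^2/2}\,dx$. Let $f:\mathbb{R}^n\to[0,\infty)$ be a log-subharmonic function. Then for every $r\in[0,1]$, $$\|f_r\|_{1/r^2,\gamma}\le \|f\|_{1,\gamma},$$ where $f_r(x)=f(rx)$.
   Context: A function $u:\mathbb{R}^n\to[-\infty,\infty)$ that is upper semicontinuous, locally integrable and not identically $-\infty$ is called subharmonic if for all $x,y\in\mathbb{R}^n$, $u(x)\le\int_{O(n)}u(x+\alpha y)\,d\alpha$, where $d\alpha$ is normalized Haar measure on the orthogonal group $O(n)$. A function $g:\mathbb{R}^n\to[0,\infty)$ is log-subharmonic if $\log g$ is subharmonic (with $\log 0=-\infty$). For a probability measure $m$ and $0<p<\infty$, $\|f\|_{p,m}=(\int|f|^p\,dm)^{1/p}\in[0,\infty]$; for $p=\infty$ it is the essential supremum norm. For $r=0$ the exponent $1/r^2$ is read as $+\infty$. *)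

theory Defs
  imports "HOL-Probability.Probability"
begin

definition gaussian :: "(real ^ 'n) measure" where
  "gaussian = density lborel
     (\<lambda>x. ennreal ((2 * pi) powr (- real CARD('n) / 2) * exp (- (norm x)\<^sup>2 / 2)))"

(* On a compact metrizable group, a left-invariant Borel probability measure is automatically
   regular, so no regularity condition is needed. *)
definition normalized_haar_O :: "(real ^ 'n ^ 'n) measure \<Rightarrow> bool" where
  "normalized_haar_O \<mu> \<longleftrightarrow>
     sets \<mu> = sets (restrict_space borel {A. orthogonal_matrix A}) \<and>
     prob_space \<mu> \<and>
     (\<forall>B. orthogonal_matrix B \<longrightarrow> distr \<mu> \<mu> (\<lambda>A. B ** A) = \<mu>)"

(* Integral of an extended-real function as positive part minus negative part; e2ennreal maps
   negative values to 0.  It is used below only for upper semicontinuous functions without the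
   value \<infinity> on a compact space, where the positive part has a finite integral, so
   the indeterminate \<infinity> - \<infinity> does not occur. *)
definition ereal_integral :: "'a measure \<Rightarrow> ('a \<Rightarrow> ereal) \<Rightarrow> ereal" where
  "ereal_integral M u =
     enn2ereal (\<integral>\<^sup>+ x. e2ennreal (u x) \<partial>M) - enn2ereal (\<integral>\<^sup>+ x. e2ennreal (- u x) \<partial>M)"

definition upper_semicontinuous :: "('a::topological_space \<Rightarrow> ereal) \<Rightarrow> bool" where
  "upper_semicontinuous u \<longleftrightarrow> (\<forall>a. open {x. u x < a})"

definition locally_integrable :: "('a::euclidean_space \<Rightarrow> ereal) \<Rightarrow> bool" where
  "locally_integrable u \<longleftrightarrow>
     u \<in> borel_measurable borel \<and>
     (\<forall>K. compact K \<longrightarrow> (\<integral>\<^sup>+ x\<in>K. e2ennreal \<bar>u x\<bar> \<partial>lborel) < \<infinity>)"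

(* The normalized Haar measure of O(n) exists and is unique, so the existential quantifier
   merely names it. *)
definition subharmonic :: "(real ^ 'n \<Rightarrow> ereal) \<Rightarrow> bool" where
  "subharmonic u \<longleftrightarrow>
     (\<forall>x. u x < \<infinity>) \<and>
     upper_semicontinuous u \<and>
     locally_integrable u \<and>
     (\<exists>x. u x \<noteq> - \<infinity>) \<and>
     (\<exists>\<mu>. normalized_haar_O \<mu> \<and>
        (\<forall>x y. u x \<le> ereal_integral \<mu> (\<lambda>A. u (x + A *v y))))"

definition log_subharmonic :: "(real ^ 'n \<Rightarrow> real) \<Rightarrow> bool" where
  "log_subharmonic g \<longleftrightarrow>
     (\<forall>x. 0 \<le> g x) \<and>
     subharmonic (\<lambda>x. if g x = 0 then - \<infinity> else ereal (ln (g x)))"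

(* Meaningful for 0 < p; p = 0 gives a junk value. *)
definition Lp_norm :: "ennreal \<Rightarrow> 'a measure \<Rightarrow> ('a \<Rightarrow> real) \<Rightarrow> ennreal" where
  "Lp_norm p M f =
     (if p = \<infinity> then esssup M (\<lambda>x. ennreal \<bar>f x\<bar>)
      else let I = (\<integral>\<^sup>+ x. ennreal (\<bar>f x\<bar> powr enn2real p) \<partial>M)
           in if I = \<infinity> then \<infinity> else ennreal (enn2real I powr (1 / enn2real p)))"

end

theory Submission
  imports Defs
begin

text \<open>
  Write \<open>s = r\<^sup>2\<close>, let \<open>X\<close>, \<open>Z\<close> be independent standard Gaussian vectors and
  \<open>Y = r X + sqrt (1 - s) Z\<close>. The core is the inequality
  \<open>E[g(X) ln f(Y) - s g(X) ln g(X)] \<le> E g ln E f - s E g ln E g\<close>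
  for arbitrary \<open>g\<close>, \<open>f\<close> with values in a compact subset of \<open>(0, \<infinity>)\<close>
  (an entropic form of hypercontractivity). It says that
  \<open>E[B(g\<^sub>t (\<surd>t X), f\<^sub>t (\<surd>t Y))]\<close>, with \<open>B(a, b) = a ln b - s a ln a\<close> and
  \<open>g\<^sub>t\<close>, \<open>f\<^sub>t\<close> the heat evolutions of \<open>g\<close>, \<open>f\<close> for time \<open>1 - t\<close>, is at \<open>t = 1\<close> at most its value at
  \<open>t = 0\<close>. A Taylor expansion shows that it grows by at most \<open>O(h\<^bsup>3/2\<^esup>)\<close> on a time step \<open>h\<close>,
  because the second order term is minus the second moment of a linear form; summing over ever smaller steps gives the claim.

  Now let \<open>u = ln f\<close> be subharmonic. Then \<open>u(r X) \<le> E[u(Y) | X]\<close>, so for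
  \<open>g(x) = f(r x)\<^bsup>1/s\<^esup>\<close> the left-hand side is nonnegative, that is
  \<open>s ln E g \<le> ln E f\<close>. To avoid integrability problems, \<open>f\<close> is replaced by
  \<open>max f \<delta>\<close>, whose logarithm satisfies the same mean value inequality, and \<open>g\<close> is truncated.
\<close>

subsection \<open>The standard Gaussian measure\<close>

text \<open>With P the average over Z, the entropic inequality is by duality the bound of exp (P (ln
  f)) in norm 1/s by f in norm 1. Hypercontractivity of P applied to f^\<epsilon> bounds (P
  f^\<epsilon>)^(1/\<epsilon>) in norm q by f in norm 1 whenever q/\<epsilon> - 1 \<le>
  (1/\<epsilon> - 1)/s; as \<epsilon> tends to 0 this becomes q \<le> 1/s, the origin of the
  exponent. Log-subharmonicity bounds P (ln f) from below by ln f(r x). The test function g is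
  chosen so that s g(X) ln g(X) = g(X) ln f(r X); what remains on the left is a mean value defect
  with a sign.

  Finite time steps replace the heat equation and differentiation under the integral: a first-order
  expansion of the smoothed functions with quadratic remainder suffices. Its constants blow up when
  the remaining smoothing time tends to 0, so the evolution is stopped at a positive residual time
  \<tau>, which is removed first for continuous functions; measurable ones follow by almost
  everywhere approximation.\<close>

definition std_gauss_density :: "'a::euclidean_space \<Rightarrow> real" where
  "std_gauss_density x = (2 * pi) powr (- real DIM('a) / 2) * exp (- (norm x)\<^sup>2 / 2)"

text \<open>Set over an arbitrary Euclidean space: a product of Euclidean spaces is again one, so an
  independent pair is a single standard Gaussian vector on \<open>'a \<times> 'a\<close>.\<close>

definition std_gauss :: "'a::euclidean_space measure" where
  "std_gauss = density lborel (\<lambda>x. ennreal (std_gauss_density x))"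

lemma gaussian_eq_std_gauss: "gaussian = (std_gauss :: (real ^ 'n) measure)"
  by (simp add: gaussian_def std_gauss_def std_gauss_density_def)

lemma std_gauss_density_pos [simp]: "0 < std_gauss_density x"
  by (simp add: std_gauss_density_def)

lemma std_gauss_density_nonneg [simp]: "0 \<le> std_gauss_density x"
  by (rule less_imp_le) simp

lemma borel_measurable_std_gauss_density [measurable]: "std_gauss_density \<in> borel_measurable borel"
  unfolding std_gauss_density_def by measurable

lemma sets_std_gauss [simp, measurable_cong]: "sets std_gauss = sets borel"
  by (simp add: std_gauss_def)

lemma space_std_gauss [simp]: "space std_gauss = UNIV"
  by (simp add: std_gauss_def)

lemma std_gauss_density_eq_prod:
  fixes x :: "'a::euclidean_space"
  shows "std_gauss_density x = (\<Prod>b\<in>Basis. std_normal_density (x \<bullet> b))"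
proof -
  have "(\<Prod>b\<in>Basis. std_normal_density (x \<bullet> b))
      = (1 / sqrt (2 * pi)) ^ DIM('a) * exp (\<Sum>b\<in>Basis. - (x \<bullet> b)\<^sup>2 / 2)"
    unfolding std_normal_density_def prod.distrib by (simp add: exp_sum)
  also have "(\<Sum>b\<in>Basis. - (x \<bullet> b)\<^sup>2 / 2) = - (norm x)\<^sup>2 / 2"
    unfolding power2_norm_eq_inner euclidean_inner [of x x]
    by (simp add: sum_negf sum_divide_distrib power2_eq_square)
  also have "(1 / sqrt (2 * pi)) ^ DIM('a) = (2 * pi) powr (- real DIM('a) / 2)"
  proof -
    have "1 / sqrt (2 * pi) = (2 * pi) powr (- (1/2))"
      by (simp add: powr_half_sqrt powr_minus_divide)
    then show ?thesis
      by (simp add: powr_powr flip: powr_realpow)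
  qed
  finally show ?thesis
    by (simp add: std_gauss_density_def)
qed

lemma nn_integral_std_gauss_density:
  "(\<integral>\<^sup>+ x. ennreal (std_gauss_density (x::'a::euclidean_space)) \<partial>lborel) = 1"
proof -
  have "(\<integral>\<^sup>+ x. ennreal (std_gauss_density (x::'a)) \<partial>lborel)
      = (\<integral>\<^sup>+ x. (\<Prod>b\<in>Basis. ennreal (std_normal_density ((x::'a) \<bullet> b))) \<partial>lborel)"
    by (simp add: std_gauss_density_eq_prod prod_ennreal)
  also have "\<dots> = (\<Prod>b\<in>(Basis::'a set). (\<integral>\<^sup>+ x. ennreal (std_normal_density x) \<partial>lborel))"
    by (rule nn_integral_lborel_prod) auto
  also have "(\<integral>\<^sup>+ x. ennreal (std_normal_density x) \<partial>lborel) = 1"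
    by (simp add: nn_integral_eq_integral)
  finally show ?thesis by simp
qed

lemma prob_space_std_gauss: "prob_space (std_gauss :: 'a::euclidean_space measure)"
  by (rule prob_spaceI)
    (simp add: std_gauss_def emeasure_density nn_integral_std_gauss_density)

interpretation std_gauss: prob_space "std_gauss :: 'a::euclidean_space measure"
  by (rule prob_space_std_gauss)

lemma emeasure_std_gauss_UNIV [simp]: "emeasure std_gauss UNIV = 1"
  using std_gauss.emeasure_space_1 by simp

lemma nn_integral_std_gauss:
  assumes [measurable]: "h \<in> borel_measurable borel"
  shows "(\<integral>\<^sup>+ x. h x \<partial>std_gauss) = (\<integral>\<^sup>+ x. ennreal (std_gauss_density x) * h x \<partial>lborel)"
  unfolding std_gauss_def by (subst nn_integral_density) auto

lemma std_gauss_density_Pair: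
  "std_gauss_density (x, y) = std_gauss_density x * std_gauss_density y"
proof -
  have e: "- real (DIM('a) + DIM('b)) / 2 = - real DIM('a) / 2 + - real DIM('b) / 2"
    by (simp add: field_simps)
  have e2: "- (norm (x, y))\<^sup>2 / 2 = - (norm x)\<^sup>2 / 2 + - (norm y)\<^sup>2 / 2"
    by (simp add: norm_Pair field_simps)
  have "std_gauss_density (x, y)
      = (2 * pi) powr (- real (DIM('a) + DIM('b)) / 2) * exp (- (norm (x, y))\<^sup>2 / 2)"
    by (simp add: std_gauss_density_def)
  then show ?thesis
    unfolding e e2 powr_add exp_add by (simp add: std_gauss_density_def)
qed

lemma std_gauss_prod:
  "std_gauss \<Otimes>\<^sub>M std_gauss = (std_gauss :: ('a::euclidean_space \<times> 'b::euclidean_space) measure)"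
proof -
  have "std_gauss \<Otimes>\<^sub>M std_gauss =
     density (lborel \<Otimes>\<^sub>M lborel) (\<lambda>(x::'a, y::'b). ennreal (std_gauss_density x) * ennreal (std_gauss_density y))"
    unfolding std_gauss_def
    by (rule pair_measure_density)
      (auto simp: std_gauss_def[symmetric] std_gauss.sigma_finite_measure_axioms sigma_finite_lborel)
  also have "\<dots> = density lborel (\<lambda>z. ennreal (std_gauss_density z))"
    unfolding lborel_prod
  proof (rule density_cong)
    have "(\<lambda>(x::'a, y::'b). ennreal (std_gauss_density x) * ennreal (std_gauss_density y))
        \<in> borel_measurable (borel \<Otimes>\<^sub>M borel)"
      by measurable
    then show "(\<lambda>(x::'a, y::'b). ennreal (std_gauss_density x) * ennreal (std_gauss_density y))
        \<in> borel_measurable lborel"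
      by (simp add: borel_prod)
  qed (auto simp: std_gauss_density_Pair ennreal_mult)
  finally show ?thesis by (simp add: std_gauss_def)
qed

section \<open>Rotation and orthogonal invariance\<close>

lemma nn_integral_lborel_affine:
  fixes t :: "'a::euclidean_space"
  assumes [measurable]: "h \<in> borel_measurable borel" and c: "c \<noteq> 0"
  shows "(\<integral>\<^sup>+ x. h x \<partial>lborel) = ennreal (\<bar>c\<bar> ^ DIM('a)) * (\<integral>\<^sup>+ x. h (t + c *\<^sub>R x) \<partial>lborel)"
  by (subst lborel_affine[OF c, of t])
    (simp add: nn_integral_density nn_integral_distr nn_integral_cmult)

text \<open>For fixed \<open>y\<close> the substitution \<open>w = c x + s y\<close> is affine in
  \<open>x\<close>. After exchanging the integrals, the joint density has the same form with the
  roles of \<open>w\<close> and \<open>y\<close> swapped, so \<open>y\<close> integrates out to 1.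
  Only scalings and translations of Lebesgue measure occur. Division by \<open>c\<close> forces the
  separate case \<open>c = 0\<close>.\<close>

lemma nn_integral_std_gauss_rotate:
  fixes h :: "'a::euclidean_space \<Rightarrow> ennreal"
  assumes [measurable]: "h \<in> borel_measurable borel"
  assumes cs: "c\<^sup>2 + s\<^sup>2 = (1::real)"
  shows "(\<integral>\<^sup>+ y. \<integral>\<^sup>+ x. h (c *\<^sub>R x + s *\<^sub>R y) \<partial>std_gauss \<partial>std_gauss) = (\<integral>\<^sup>+ x. h x \<partial>std_gauss)"
proof (cases "c = 0")
  case True
  then have "s = 1 \<or> s = -1"
    using cs by (simp add: power2_eq_1_iff)
  moreover have "(\<integral>\<^sup>+ y. h (- y) \<partial>std_gauss) = (\<integral>\<^sup>+ y. h y \<partial>std_gauss)"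
    unfolding nn_integral_std_gauss[OF assms(1)]
    by (subst nn_integral_lborel_affine[where c="-1" and t=0])
      (auto simp: nn_integral_std_gauss std_gauss_density_def)
  ultimately show ?thesis
    using True by (auto simp: nn_integral_const)
next
  case False
  \<comment> \<open>With \<open>x = (w - s y) / c\<close>, the vector \<open>(y - s w) / c\<close>
    equals \<open>c y - s x\<close>, the other coordinate of the rotated pair; the identity says
    that the rotation preserves the norm.\<close>
  have inner: "(norm ((w - s *\<^sub>R y) /\<^sub>R c))\<^sup>2 + (norm y)\<^sup>2
      = (norm ((y - s *\<^sub>R w) /\<^sub>R c))\<^sup>2 + (norm w)\<^sup>2" for w y :: 'a
  proof -
    have "(norm (w - s *\<^sub>R y))\<^sup>2 + c\<^sup>2 * (norm y)\<^sup>2 = (norm (y - s *\<^sub>R w))\<^sup>2 + c\<^sup>2 * (norm w)\<^sup>2"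
      unfolding power2_norm_eq_inner eq_diff_eq[THEN iffD2, OF cs]
      by (simp add: algebra_simps inner_commute power2_eq_square)
    then show ?thesis
      using False by (simp add: power_mult_distrib divide_simps mult.commute)
  qed
  have dens: "std_gauss_density ((w - s *\<^sub>R y) /\<^sub>R c) * std_gauss_density y
      = std_gauss_density ((y - s *\<^sub>R w) /\<^sub>R c) * std_gauss_density w" for w y :: 'a
  proof -
    have "exp (- (norm ((w - s *\<^sub>R y) /\<^sub>R c))\<^sup>2 / 2) * exp (- (norm y)\<^sup>2 / 2)
        = exp (- (norm ((y - s *\<^sub>R w) /\<^sub>R c))\<^sup>2 / 2) * exp (- (norm w)\<^sup>2 / 2)"
      unfolding mult_exp_exp using inner[of w y] by (simp add: field_simps)
    then show ?thesis
      unfolding std_gauss_density_def by (simp add: ac_simps)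
  qed
  let ?C = "ennreal (\<bar>1 / c\<bar> ^ DIM('a))"
  have sub: "(\<integral>\<^sup>+ x. g ((x - t) /\<^sub>R c) \<partial>lborel) * ?C = (\<integral>\<^sup>+ x. g x \<partial>lborel)"
    if [measurable]: "g \<in> borel_measurable borel" for g :: "'a \<Rightarrow> ennreal" and t
    using False by (subst (2) nn_integral_lborel_affine[where c="1/c" and t="- (t /\<^sub>R c)"])
      (auto simp: scaleR_diff_right mult.commute divide_inverse)
  have "(\<integral>\<^sup>+ y. \<integral>\<^sup>+ x. h (c *\<^sub>R x + s *\<^sub>R y) \<partial>std_gauss \<partial>std_gauss)
      = (\<integral>\<^sup>+ y. ennreal (std_gauss_density y) *
           (\<integral>\<^sup>+ x. ennreal (std_gauss_density x) * h (c *\<^sub>R x + s *\<^sub>R y) \<partial>lborel) \<partial>lborel)"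
    by (simp add: nn_integral_std_gauss)
  also have "\<dots> = (\<integral>\<^sup>+ y. ennreal (std_gauss_density y) *
           ((\<integral>\<^sup>+ w. ennreal (std_gauss_density ((w - s *\<^sub>R y) /\<^sub>R c)) * h w \<partial>lborel) * ?C) \<partial>lborel)"
  proof (intro nn_integral_cong arg_cong2[where f="(*)"] refl)
    fix y :: 'a
    show "(\<integral>\<^sup>+ x. ennreal (std_gauss_density x) * h (c *\<^sub>R x + s *\<^sub>R y) \<partial>lborel)
        = (\<integral>\<^sup>+ w. ennreal (std_gauss_density ((w - s *\<^sub>R y) /\<^sub>R c)) * h w \<partial>lborel) * ?C"
      using False by (subst sub[symmetric, of _ "s *\<^sub>R y"]) auto
  qed
  also have "\<dots> = (\<integral>\<^sup>+ y. (\<integral>\<^sup>+ w. ennreal (std_gauss_density y) *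
           (ennreal (std_gauss_density ((w - s *\<^sub>R y) /\<^sub>R c)) * h w) * ?C \<partial>lborel) \<partial>lborel)"
    by (intro nn_integral_cong, subst nn_integral_multc, measurable, subst nn_integral_cmult, measurable)
      (simp add: mult.assoc)
  also have "\<dots> = (\<integral>\<^sup>+ w. (\<integral>\<^sup>+ y. ennreal (std_gauss_density y) *
           (ennreal (std_gauss_density ((w - s *\<^sub>R y) /\<^sub>R c)) * h w) * ?C \<partial>lborel) \<partial>lborel)"
    by (rule lborel_pair.Fubini') measurable
  also have "\<dots> = (\<integral>\<^sup>+ w. (\<integral>\<^sup>+ y. (ennreal (std_gauss_density w) * h w) *
           (ennreal (std_gauss_density ((y - s *\<^sub>R w) /\<^sub>R c)) * ?C) \<partial>lborel) \<partial>lborel)"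
  proof (intro nn_integral_cong)
    fix w y :: 'a
    have "ennreal (std_gauss_density y) * ennreal (std_gauss_density ((w - s *\<^sub>R y) /\<^sub>R c))
        = ennreal (std_gauss_density w) * ennreal (std_gauss_density ((y - s *\<^sub>R w) /\<^sub>R c))"
      using dens[of w y] by (simp flip: ennreal_mult add: mult.commute)
    moreover have "a * (b * h w) * ?C = (p * h w) * (q * ?C)" if "a * b = p * q" for a b p q :: ennreal
    proof -
      have "a * (b * h w) * ?C = (a * b) * (h w * ?C)" by (simp only: mult_ac)
      also have "\<dots> = (p * h w) * (q * ?C)" unfolding that by (simp only: mult_ac)
      finally show ?thesis .
    qed
    ultimately show "ennreal (std_gauss_density y) *
           (ennreal (std_gauss_density ((w - s *\<^sub>R y) /\<^sub>R c)) * h w) * ?C =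
        (ennreal (std_gauss_density w) * h w) *
           (ennreal (std_gauss_density ((y - s *\<^sub>R w) /\<^sub>R c)) * ?C)"
      by blast
  qed
  also have "\<dots> = (\<integral>\<^sup>+ w. (ennreal (std_gauss_density w) * h w) *
      ((\<integral>\<^sup>+ y. ennreal (std_gauss_density ((y - s *\<^sub>R w) /\<^sub>R c)) \<partial>lborel) * ?C) \<partial>lborel)"
    by (simp add: nn_integral_cmult nn_integral_multc)
  also have "\<dots> = (\<integral>\<^sup>+ w. ennreal (std_gauss_density w) * h w \<partial>lborel)"
    by (subst sub) (auto simp: nn_integral_std_gauss_density)
  finally show ?thesis by (simp add: nn_integral_std_gauss)
qed

interpretation std_gauss_pair: pair_sigma_finite "std_gauss :: 'a::euclidean_space measure" "std_gauss :: 'b::euclidean_space measure" ..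

lemma nn_integral_std_gauss_Pair:
  assumes [measurable]: "h \<in> borel_measurable borel"
  shows "(\<integral>\<^sup>+ z. h z \<partial>std_gauss) = (\<integral>\<^sup>+ x. \<integral>\<^sup>+ y. h (x, y) \<partial>std_gauss \<partial>std_gauss)"
  unfolding std_gauss_prod[symmetric]
  by (rule std_gauss.nn_integral_fst[symmetric]) (simp add: measurable_cong_sets[OF sets_pair_measure_cong[OF sets_std_gauss sets_std_gauss] refl] borel_prod)

lemma borel_measurable_rotate:
  "(\<lambda>z::'a::euclidean_space \<times> 'a. c *\<^sub>R fst z + s *\<^sub>R snd z) \<in> borel \<rightarrow>\<^sub>M borel"
  by (intro borel_measurable_continuous_onI continuous_intros)

lemma distr_std_gauss_rotate:
  assumes cs: "c\<^sup>2 + s\<^sup>2 = (1::real)"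
  shows "distr std_gauss borel (\<lambda>z. c *\<^sub>R fst z + s *\<^sub>R snd z) = (std_gauss :: 'a::euclidean_space measure)"
proof (rule measure_eqI)
  fix A assume "A \<in> sets (distr (std_gauss::('a\<times>'a) measure) borel (\<lambda>z. c *\<^sub>R fst z + s *\<^sub>R snd z))"
  then have [measurable]: "A \<in> sets borel" by simp
  have "emeasure (distr std_gauss borel (\<lambda>z. c *\<^sub>R fst z + s *\<^sub>R snd z)) A
      = (\<integral>\<^sup>+ z. indicator A z \<partial>distr std_gauss borel (\<lambda>z::'a\<times>'a. c *\<^sub>R fst z + s *\<^sub>R snd z))"
    by simp
  also have "\<dots> = (\<integral>\<^sup>+ z. indicator A (c *\<^sub>R fst z + s *\<^sub>R snd z) \<partial>std_gauss)"
    by (subst nn_integral_distr)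
      (auto simp: measurable_cong_sets[OF sets_std_gauss refl] borel_measurable_rotate)
  also have "\<dots> = (\<integral>\<^sup>+ x. \<integral>\<^sup>+ y. indicator A (s *\<^sub>R y + c *\<^sub>R x) \<partial>std_gauss \<partial>std_gauss)"
    by (subst nn_integral_std_gauss_Pair)
      (auto simp: add.commute intro!: measurable_compose[OF borel_measurable_rotate])
  also have "\<dots> = (\<integral>\<^sup>+ x. indicator A x \<partial>std_gauss)"
    using cs by (intro nn_integral_std_gauss_rotate) auto
  finally show "emeasure (distr std_gauss borel (\<lambda>z::'a\<times>'a. c *\<^sub>R fst z + s *\<^sub>R snd z)) A = emeasure std_gauss A"
    by simp
qed simp


text \<open>A factor 1, written as the integral of the Gaussian density over \<open>x\<close>, is
  inserted. Translation invariance turns \<open>g (T y)\<close> into \<open>g (x + T y)\<close>, and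
  shifting \<open>x\<close> by \<open>T y\<close> moves \<open>T\<close> from \<open>g\<close> to
  the density. The density is radial, so \<open>T\<close> disappears there and the
  \<open>y\<close>-integral is 1.\<close>

lemma nn_integral_lborel_orthogonal:
  fixes T :: "'a::euclidean_space \<Rightarrow> 'a"
  assumes T: "orthogonal_transformation T" and [measurable]: "g \<in> borel_measurable borel"
  shows "(\<integral>\<^sup>+ x. g (T x) \<partial>lborel) = (\<integral>\<^sup>+ x. g x \<partial>lborel)"
proof -
  let ?f = "\<lambda>x::'a. ennreal (std_gauss_density x)"
  have lin: "linear T" using T by (rule orthogonal_transformation_linear)
  have [measurable]: "T \<in> borel \<rightarrow>\<^sub>M borel"
    by (intro borel_measurable_continuous_onI linear_continuous_on linear_conv_bounded_linear[THEN iffD1] lin)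
  have fT: "?f (T x) = ?f x" for x
    using T by (simp add: std_gauss_density_def orthogonal_transformation_norm)
  define S where "S = inv T"
  have TS: "T (S x) = x" for x
    unfolding S_def using orthogonal_transformation_surj[OF T] by (simp add: surj_f_inv_f)
  have "(\<integral>\<^sup>+ y. g (T y) \<partial>lborel) = (\<integral>\<^sup>+ x. ?f x * (\<integral>\<^sup>+ y. g (T y) \<partial>lborel) \<partial>lborel)"
    by (simp add: nn_integral_multc nn_integral_std_gauss_density)
  also have "\<dots> = (\<integral>\<^sup>+ x. ?f x * (\<integral>\<^sup>+ y. g (x + T y) \<partial>lborel) \<partial>lborel)"
  proof (rule nn_integral_cong, rule arg_cong2[where f="(*)", OF refl])
    fix x :: 'a
    show "(\<integral>\<^sup>+ y. g (T y) \<partial>lborel) = (\<integral>\<^sup>+ y. g (x + T y) \<partial>lborel)"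
      by (subst nn_integral_lborel_affine[where c=1 and t="S x"])
        (auto simp: linear_add[OF lin] TS)
  qed
  also have "\<dots> = (\<integral>\<^sup>+ x. \<integral>\<^sup>+ y. ?f x * g (x + T y) \<partial>lborel \<partial>lborel)"
    by (simp add: nn_integral_cmult)
  also have "\<dots> = (\<integral>\<^sup>+ y. \<integral>\<^sup>+ x. ?f x * g (x + T y) \<partial>lborel \<partial>lborel)"
    by (rule lborel_pair.Fubini') measurable
  also have "\<dots> = (\<integral>\<^sup>+ y. \<integral>\<^sup>+ x. ?f (x - T y) * g x \<partial>lborel \<partial>lborel)"
  proof (rule nn_integral_cong)
    fix y :: 'a
    show "(\<integral>\<^sup>+ x. ?f x * g (x + T y) \<partial>lborel) = (\<integral>\<^sup>+ x. ?f (x - T y) * g x \<partial>lborel)"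
      by (subst (2) nn_integral_lborel_affine[where c=1 and t="T y"]) (auto simp: add.commute)
  qed
  also have "\<dots> = (\<integral>\<^sup>+ x. \<integral>\<^sup>+ y. ?f (x - T y) * g x \<partial>lborel \<partial>lborel)"
    by (rule lborel_pair.Fubini') measurable
  also have "\<dots> = (\<integral>\<^sup>+ x. (\<integral>\<^sup>+ y. ?f (x - T y) \<partial>lborel) * g x \<partial>lborel)"
    by (simp add: nn_integral_multc)
  also have "\<dots> = (\<integral>\<^sup>+ x. g x \<partial>lborel)"
  proof (intro nn_integral_cong)
    fix x :: 'a
    have "(\<integral>\<^sup>+ y. ?f (x - T y) \<partial>lborel) = (\<integral>\<^sup>+ y. ?f (x - T (S x + (- 1) *\<^sub>R y)) \<partial>lborel)"
      by (subst nn_integral_lborel_affine[where c="-1" and t="S x"]) auto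
    also have "\<dots> = 1"
      by (simp add: linear_diff[OF lin] TS fT nn_integral_std_gauss_density)
    finally show "(\<integral>\<^sup>+ y. ?f (x - T y) \<partial>lborel) * g x = g x" by simp
  qed
  finally show ?thesis .
qed

lemma borel_measurable_orthogonal_transformation:
  fixes T :: "'a::euclidean_space \<Rightarrow> 'a"
  assumes "orthogonal_transformation T"
  shows "T \<in> borel \<rightarrow>\<^sub>M borel"
  by (intro borel_measurable_continuous_onI linear_continuous_on linear_conv_bounded_linear[THEN iffD1]
      orthogonal_transformation_linear assms)

lemma nn_integral_std_gauss_orthogonal:
  fixes T :: "'a::euclidean_space \<Rightarrow> 'a"
  assumes T: "orthogonal_transformation T" and [measurable]: "g \<in> borel_measurable borel"
  shows "(\<integral>\<^sup>+ x. g (T x) \<partial>std_gauss) = (\<integral>\<^sup>+ x. g x \<partial>std_gauss)"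
proof -
  note [measurable] = borel_measurable_orthogonal_transformation[OF T]
  have "(\<integral>\<^sup>+ x. g (T x) \<partial>std_gauss) = (\<integral>\<^sup>+ x. ennreal (std_gauss_density (T x)) * g (T x) \<partial>lborel)"
    using T by (simp add: nn_integral_std_gauss std_gauss_density_def orthogonal_transformation_norm)
  also have "\<dots> = (\<integral>\<^sup>+ x. ennreal (std_gauss_density x) * g x \<partial>lborel)"
    using T by (rule nn_integral_lborel_orthogonal) measurable
  finally show ?thesis by (simp add: nn_integral_std_gauss)
qed

lemma distr_std_gauss_orthogonal:
  fixes T :: "'a::euclidean_space \<Rightarrow> 'a"
  assumes T: "orthogonal_transformation T"
  shows "distr std_gauss borel T = std_gauss"
proof (rule measure_eqI)
  note [measurable] = borel_measurable_orthogonal_transformation[OF T]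
  fix A assume "A \<in> sets (distr std_gauss borel T)"
  then have [measurable]: "A \<in> sets borel" by simp
  have "emeasure (distr std_gauss borel T) A = (\<integral>\<^sup>+ x. indicator A x \<partial>distr std_gauss borel T)"
    by simp
  also have "\<dots> = (\<integral>\<^sup>+ x. indicator A (T x) \<partial>std_gauss)"
    by (subst nn_integral_distr) auto
  also have "\<dots> = emeasure std_gauss A"
    using T by (subst nn_integral_std_gauss_orthogonal) auto
  finally show "emeasure (distr std_gauss borel T) A = emeasure std_gauss A" .
qed simp

section \<open>Marginals, translations and exponential moments\<close>

lemma distr_std_gauss_fst:
  "distr (std_gauss :: ('a::euclidean_space \<times> 'b::euclidean_space) measure) borel fst = std_gauss"
proof (rule measure_eqI)
  fix A assume "A \<in> sets (distr (std_gauss :: ('a \<times> 'b) measure) borel fst)"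
  then have [measurable]: "A \<in> sets borel" by simp
  have m: "(fst :: 'a \<times> 'b \<Rightarrow> 'a) \<in> borel \<rightarrow>\<^sub>M borel"
    by (intro borel_measurable_continuous_onI continuous_intros)
  have "emeasure (distr (std_gauss :: ('a \<times> 'b) measure) borel fst) A
      = (\<integral>\<^sup>+ x. indicator A x \<partial>distr (std_gauss :: ('a \<times> 'b) measure) borel fst)"
    by simp
  also have "\<dots> = (\<integral>\<^sup>+ z. indicator A (fst z) \<partial>(std_gauss :: ('a \<times> 'b) measure))"
    by (subst nn_integral_distr) (auto simp: measurable_cong_sets[OF sets_std_gauss refl] m)
  also have "\<dots> = emeasure std_gauss A"
    by (subst nn_integral_std_gauss_Pair) (auto intro!: measurable_compose[OF m])
  finally show "emeasure (distr (std_gauss :: ('a \<times> 'b) measure) borel fst) A = emeasure std_gauss A" .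
qed simp

lemma std_gauss_density_shift:
  "std_gauss_density (z - w) = std_gauss_density z * exp (z \<bullet> w - (norm w)\<^sup>2 / 2)"
proof -
  have "- (norm (z - w))\<^sup>2 / 2 = - (norm z)\<^sup>2 / 2 + (z \<bullet> w - (norm w)\<^sup>2 / 2)"
    by (simp add: power2_norm_eq_inner algebra_simps inner_commute field_simps)
  then show ?thesis
    unfolding std_gauss_density_def by (simp only: exp_add mult.assoc)
qed

lemma distr_std_gauss_shift:
  "distr std_gauss borel (\<lambda>z. z + w) = density std_gauss (\<lambda>z. ennreal (exp (z \<bullet> w - (norm w)\<^sup>2 / 2)))"
proof (rule measure_eqI)
  fix A assume "A \<in> sets (distr std_gauss borel (\<lambda>z. z + w))"
  then have [measurable]: "A \<in> sets borel" by simp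
  have "emeasure (distr std_gauss borel (\<lambda>z. z + w)) A
      = (\<integral>\<^sup>+ x. indicator A x \<partial>distr std_gauss borel (\<lambda>z. z + w))"
    by simp
  also have "\<dots> = (\<integral>\<^sup>+ z. indicator A (z + w) \<partial>std_gauss)"
    by (subst nn_integral_distr) auto
  also have "\<dots> = (\<integral>\<^sup>+ z. ennreal (std_gauss_density z) * indicator A (z + w) \<partial>lborel)"
    by (simp add: nn_integral_std_gauss)
  also have "\<dots> = (\<integral>\<^sup>+ z. ennreal (std_gauss_density (z - w)) * indicator A z \<partial>lborel)"
    by (subst (2) nn_integral_lborel_affine[where c=1 and t=w]) (auto simp: add.commute)
  also have "\<dots> = (\<integral>\<^sup>+ z. ennreal (exp (z \<bullet> w - (norm w)\<^sup>2 / 2)) * indicator A z \<partial>std_gauss)"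
    by (simp add: nn_integral_std_gauss std_gauss_density_shift ennreal_mult mult.assoc)
  also have "\<dots> = emeasure (density std_gauss (\<lambda>z. ennreal (exp (z \<bullet> w - (norm w)\<^sup>2 / 2)))) A"
    by (simp add: emeasure_density)
  finally show "emeasure (distr std_gauss borel (\<lambda>z. z + w)) A
      = emeasure (density std_gauss (\<lambda>z. ennreal (exp (z \<bullet> w - (norm w)\<^sup>2 / 2)))) A" .
qed simp

text \<open>By \<open>(k - norm z / 2)\<^sup>2 \<ge> 0\<close>, half of the Gaussian exponent
  absorbs \<open>k * norm z\<close> at the cost of a factor \<open>exp (k\<^sup>2)\<close>; the
  other half is the density at \<open>z / sqrt 2\<close>, integrable by scaling. The majorants of
  later sections reduce to this one.\<close>

lemma integrable_std_gauss_exp_norm: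
  "integrable std_gauss (\<lambda>z::'a::euclidean_space. exp (k * norm z))"
proof (rule integrableI_nonneg)
  have "(\<integral>\<^sup>+ z. ennreal (exp (k * norm (z::'a))) \<partial>std_gauss)
      = (\<integral>\<^sup>+ z. ennreal (std_gauss_density z * exp (k * norm (z::'a))) \<partial>lborel)"
    by (simp add: nn_integral_std_gauss ennreal_mult)
  also have "\<dots> \<le> (\<integral>\<^sup>+ z. ennreal (exp (k\<^sup>2)) * ennreal (std_gauss_density (0 + (1 / sqrt 2) *\<^sub>R (z::'a))) \<partial>lborel)"
  proof (intro nn_integral_mono)
    fix z :: 'a
    have "k * norm z \<le> k\<^sup>2 + (norm z)\<^sup>2 / 4"
      using zero_le_power2[of "k - norm z / 2"] by (simp add: power2_diff power_divide)
    then have "- (norm z)\<^sup>2 / 2 + k * norm z \<le> k\<^sup>2 + - (norm z)\<^sup>2 / 4" by simp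
    then have "exp (- (norm z)\<^sup>2 / 2) * exp (k * norm z) \<le> exp (k\<^sup>2) * exp (- (norm z)\<^sup>2 / 4)"
      unfolding mult_exp_exp by simp
    then have "std_gauss_density z * exp (k * norm z)
        \<le> exp (k\<^sup>2) * std_gauss_density (0 + (1 / sqrt 2) *\<^sub>R z)"
      by (simp add: std_gauss_density_def power_mult_distrib power_divide mult.assoc mult.left_commute[of "exp _"])
    then show "ennreal (std_gauss_density z * exp (k * norm z))
        \<le> ennreal (exp (k\<^sup>2)) * ennreal (std_gauss_density (0 + (1 / sqrt 2) *\<^sub>R z))"
      by (simp flip: ennreal_mult add: ennreal_leI)
  qed
  also have "\<dots> = ennreal (exp (k\<^sup>2)) * (\<integral>\<^sup>+ z. ennreal (std_gauss_density (0 + (1 / sqrt 2) *\<^sub>R (z::'a))) \<partial>lborel)"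
    by (rule nn_integral_cmult) measurable
  also have "\<dots> < \<infinity>"
  proof -
    let ?I = "\<integral>\<^sup>+ z. ennreal (std_gauss_density (0 + (1 / sqrt 2) *\<^sub>R (z::'a))) \<partial>lborel"
    have "ennreal (\<bar>1 / sqrt 2\<bar> ^ DIM('a)) * ?I = 1"
      using nn_integral_lborel_affine[of "\<lambda>z::'a. ennreal (std_gauss_density z)" "1 / sqrt 2" 0]
      by (simp add: nn_integral_std_gauss_density)
    then have "?I \<noteq> \<infinity>"
      by (auto simp: ennreal_mult_top)
    then show ?thesis
      by (simp add: ennreal_mult_less_top less_top)
  qed
  finally show "(\<integral>\<^sup>+ z. ennreal (exp (k * norm (z::'a))) \<partial>std_gauss) < \<infinity>" .
qed auto

lemma integrable_std_gauss_norm: "integrable std_gauss (\<lambda>z::'a::euclidean_space. norm z)"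
proof (rule Bochner_Integration.integrable_bound[OF integrable_std_gauss_exp_norm[of 1]])
  show "AE z in std_gauss. norm (norm (z::'a)) \<le> norm (exp (1 * norm z))"
    using exp_ge_add_one_self by (auto intro!: AE_I2 order.trans[OF _ exp_ge_add_one_self])
qed auto

subsection \<open>A local two-function inequality\<close>

lemma nonneg_if_deriv_sign:
  fixes f f' :: "real \<Rightarrow> real"
  assumes deriv: "\<And>x. -1 < x \<Longrightarrow> (f has_real_derivative f' x) (at x)"
    and pos: "\<And>x. 0 \<le> x \<Longrightarrow> 0 \<le> f' x" and neg: "\<And>x. -1 < x \<Longrightarrow> x \<le> 0 \<Longrightarrow> f' x \<le> 0"
    and zero: "f 0 = 0" and x: "-1 < x"
  shows "0 \<le> f x"
proof (cases "0 \<le> x")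
  case True
  have "f 0 \<le> f x"
  proof (rule DERIV_nonneg_imp_nondecreasing[OF True])
    fix y assume "0 \<le> y" "y \<le> x"
    then show "\<exists>d. (f has_real_derivative d) (at y) \<and> 0 \<le> d"
      using deriv[of y] pos[of y] by (intro exI[of _ "f' y"]) simp
  qed
  then show ?thesis using zero by simp
next
  case False
  have "f x \<ge> f 0"
  proof (rule DERIV_nonpos_imp_nonincreasing[of x 0])
    fix y assume "x \<le> y" "y \<le> 0"
    then show "\<exists>d. (f has_real_derivative d) (at y) \<and> d \<le> 0"
      using deriv[of y] neg[of y] x by (intro exI[of _ "f' y"]) simp
  qed (use False in simp)
  then show ?thesis using zero by simp
qed

text \<open>The difference has derivative \<open>x ^ 3 / (1 + x)\<close>, hence its minimum at 0.
  The bound is global on the domain of the logarithm: relative increments of the smoothed functions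
  are bounded but not small, so a local expansion would not do.\<close>

lemma ln_one_plus_le_cubic:
  assumes "-1 < (x::real)"
  shows "ln (1 + x) \<le> x - x\<^sup>2 / 2 + x ^ 3 / 3"
proof -
  have "0 \<le> x - x\<^sup>2 / 2 + x ^ 3 / 3 - ln (1 + x)"
  proof (rule nonneg_if_deriv_sign[where f = "\<lambda>x. x - x\<^sup>2 / 2 + x ^ 3 / 3 - ln (1 + x)" and f' = "\<lambda>x. x ^ 3 / (1 + x)"])
    fix y :: real assume "-1 < y"
    then show "((\<lambda>x. x - x\<^sup>2 / 2 + x ^ 3 / 3 - ln (1 + x)) has_real_derivative y ^ 3 / (1 + y)) (at y)"
      by (auto intro!: derivative_eq_intros simp: divide_simps) (simp add: algebra_simps power2_eq_square power3_eq_cube)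
  qed (use assms in \<open>auto simp: divide_nonpos_pos power_le_zero_eq\<close>)
  then show ?thesis by simp
qed

text \<open>This expression is the derivative of the difference estimated in
  \<open>mult_ln_one_plus_ge_cubic\<close>; it is increasing and vanishes at 0.\<close>

lemma ln_one_plus_quadratic_sign:
  assumes x: "-1 < (x::real)"
  shows "0 \<le> x \<Longrightarrow> 0 \<le> ln (1 + x) - x + x\<^sup>2 / 2" and "x \<le> 0 \<Longrightarrow> ln (1 + x) - x + x\<^sup>2 / 2 \<le> 0"
proof -
  have mono: "ln (1 + a) - a + a\<^sup>2 / 2 \<le> ln (1 + b) - b + b\<^sup>2 / 2" if "-1 < a" "a \<le> b" for a b :: real
  proof (rule DERIV_nonneg_imp_nondecreasing[OF that(2)])
    fix y assume "a \<le> y" "y \<le> b"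
    then have "-1 < y" using that by simp
    then have "((\<lambda>x. ln (1 + x) - x + x\<^sup>2 / 2) has_real_derivative y\<^sup>2 / (1 + y)) (at y)"
      by (auto intro!: derivative_eq_intros simp: divide_simps) (simp add: algebra_simps power2_eq_square)
    then show "\<exists>d. ((\<lambda>x. ln (1 + x) - x + x\<^sup>2 / 2) has_real_derivative d) (at y) \<and> 0 \<le> d"
      using \<open>-1 < y\<close> by (intro exI[of _ "y\<^sup>2 / (1 + y)"]) auto
  qed
  show "0 \<le> x \<Longrightarrow> 0 \<le> ln (1 + x) - x + x\<^sup>2 / 2" and "x \<le> 0 \<Longrightarrow> ln (1 + x) - x + x\<^sup>2 / 2 \<le> 0"
    using mono[of 0 x] mono[of x 0] x by simp_all
qed

lemma mult_ln_one_plus_ge_cubic: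
  assumes "-1 < (x::real)"
  shows "x + x\<^sup>2 / 2 - x ^ 3 / 6 \<le> (1 + x) * ln (1 + x)"
proof -
  have "0 \<le> (1 + x) * ln (1 + x) - x - x\<^sup>2 / 2 + x ^ 3 / 6"
  proof (rule nonneg_if_deriv_sign[where f = "\<lambda>x. (1 + x) * ln (1 + x) - x - x\<^sup>2 / 2 + x ^ 3 / 6"
        and f' = "\<lambda>x. ln (1 + x) - x + x\<^sup>2 / 2"])
    fix y :: real assume "-1 < y"
    then show "((\<lambda>x. (1 + x) * ln (1 + x) - x - x\<^sup>2 / 2 + x ^ 3 / 6) has_real_derivative ln (1 + y) - y + y\<^sup>2 / 2) (at y)"
      by (auto intro!: derivative_eq_intros)
  qed (use assms ln_one_plus_quadratic_sign in auto)
  then show ?thesis by simp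
qed

text \<open>In the intended use \<open>P\<close> and \<open>Q\<close> are the linear parts of the
  increments \<open>\<psi>\<close> and \<open>\<phi>\<close>, and \<open>D\<close> is of the order
  of \<open>u\<close>, so that every error is cubic in \<open>u\<close>: replacing
  \<open>\<psi>\<close>, \<open>\<phi>\<close> by \<open>P\<close>, \<open>Q\<close> in the
  quadratic terms costs multiples of \<open>u * D\<^sup>2\<close>, and in the one quartic term
  \<open>\<psi> * \<phi> ^ 3\<close> the factor \<open>\<psi>\<close> is bounded by the coarse
  constant \<open>A\<close>.\<close>

lemma entropy_taylor:
  fixes \<psi> \<phi> :: real
  assumes "-1 < \<psi>" "-1 < \<phi>" "0 \<le> s" "s \<le> 1" "0 \<le> u"
    and b: "\<bar>\<psi>\<bar> \<le> D" "\<bar>\<phi>\<bar> \<le> D" "\<bar>P\<bar> \<le> D" "\<bar>Q\<bar> \<le> D" "\<bar>\<psi> - P\<bar> \<le> u * D" "\<bar>\<phi> - Q\<bar> \<le> u * D"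
    and A: "\<bar>\<psi>\<bar> \<le> A"
  shows "(1 + \<psi>) * ln (1 + \<phi>) - s * ((1 + \<psi>) * ln (1 + \<psi>))
     \<le> \<phi> - s * \<psi> + (P * Q - Q\<^sup>2 / 2 - s * P\<^sup>2 / 2) + 4 * u * D\<^sup>2 + D ^ 3 * (1 + A)"
proof -
  have D: "0 \<le> D" using b(1) by linarith
  have A0: "0 \<le> A" using A by linarith
  have 1: "(1 + \<psi>) * ln (1 + \<phi>) \<le> (1 + \<psi>) * (\<phi> - \<phi>\<^sup>2 / 2 + \<phi> ^ 3 / 3)"
    using assms by (intro mult_left_mono ln_one_plus_le_cubic) auto
  have 2: "s * (\<psi> + \<psi>\<^sup>2 / 2 - \<psi> ^ 3 / 6) \<le> s * ((1 + \<psi>) * ln (1 + \<psi>))"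
    using assms by (intro mult_left_mono mult_ln_one_plus_ge_cubic) auto
  have cub: "\<bar>x * y * z\<bar> \<le> D ^ 3" if "\<bar>x\<bar> \<le> D" "\<bar>y\<bar> \<le> D" "\<bar>z\<bar> \<le> D" for x y z :: real
    unfolding abs_mult power3_eq_cube using that D by (intro mult_mono) auto
  have c1: "\<phi> ^ 3 \<le> D ^ 3" using cub[of \<phi> \<phi> \<phi>] b by (simp add: power3_eq_cube)
  have c2: "- (\<psi> * \<phi>\<^sup>2) \<le> D ^ 3" using cub[of \<psi> \<phi> \<phi>] b by (simp add: power2_eq_square mult.assoc)
  have c3: "\<psi> * \<phi> ^ 3 \<le> A * D ^ 3"
  proof -
    have "\<bar>\<psi>\<bar> * \<bar>\<phi> * \<phi> * \<phi>\<bar> \<le> A * D ^ 3"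
      using cub[of \<phi> \<phi> \<phi>] b A A0 by (intro mult_mono) auto
    moreover have "\<psi> * \<phi> ^ 3 \<le> \<bar>\<psi>\<bar> * \<bar>\<phi> * \<phi> * \<phi>\<bar>"
      by (simp add: power3_eq_cube mult.assoc flip: abs_mult)
    ultimately show ?thesis by linarith
  qed
  have c4: "s * \<psi> ^ 3 \<le> D ^ 3"
  proof -
    have "\<psi> ^ 3 \<le> D ^ 3" using cub[of \<psi> \<psi> \<psi>] b by (simp add: power3_eq_cube)
    then have "s * \<psi> ^ 3 \<le> s * D ^ 3" using assms by (intro mult_left_mono) auto
    also have "\<dots> \<le> 1 * D ^ 3" using assms D by (intro mult_right_mono) auto
    finally show ?thesis by simp
  qed
  have quad: "\<bar>x * y - z * w\<bar> \<le> 2 * u * D\<^sup>2"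
    if "\<bar>x\<bar> \<le> D" "\<bar>w\<bar> \<le> D" "\<bar>x - z\<bar> \<le> u * D" "\<bar>y - w\<bar> \<le> u * D" for x y z w :: real
  proof -
    have "\<bar>x * y - z * w\<bar> = \<bar>x * (y - w) + w * (x - z)\<bar>" by (simp add: algebra_simps)
    also have "\<dots> \<le> \<bar>x\<bar> * \<bar>y - w\<bar> + \<bar>w\<bar> * \<bar>x - z\<bar>"
      by (simp flip: abs_mult)
    also have "\<dots> \<le> D * (u * D) + D * (u * D)"
      using that D \<open>0 \<le> u\<close> by (intro add_mono mult_mono) auto
    finally show ?thesis by (simp add: power2_eq_square mult_ac)
  qed
  have q1: "\<bar>\<psi> * \<phi> - P * Q\<bar> \<le> 2 * u * D\<^sup>2" using quad[of \<psi> Q P \<phi>] b by simp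
  have q2: "\<bar>\<phi>\<^sup>2 - Q\<^sup>2\<bar> \<le> 2 * u * D\<^sup>2" using quad[of \<phi> Q Q \<phi>] b by (simp add: power2_eq_square)
  have q3: "s * (P\<^sup>2 - \<psi>\<^sup>2) \<le> 2 * u * D\<^sup>2"
  proof -
    have "\<bar>\<psi>\<^sup>2 - P\<^sup>2\<bar> \<le> 2 * u * D\<^sup>2" using quad[of \<psi> P P \<psi>] b by (simp add: power2_eq_square)
    then have "s * (P\<^sup>2 - \<psi>\<^sup>2) \<le> s * (2 * u * D\<^sup>2)" using assms by (intro mult_left_mono) auto
    also have "\<dots> \<le> 1 * (2 * u * D\<^sup>2)" using assms D by (intro mult_right_mono) auto
    finally show ?thesis by simp
  qed
  have AD: "0 \<le> A * D ^ 3" using A0 D by simp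
  have "(1 + \<psi>) * (\<phi> - \<phi>\<^sup>2 / 2 + \<phi> ^ 3 / 3) - s * (\<psi> + \<psi>\<^sup>2 / 2 - \<psi> ^ 3 / 6)
     = \<phi> - s * \<psi> + (P * Q - Q\<^sup>2 / 2 - s * P\<^sup>2 / 2) + (\<psi> * \<phi> - P * Q) - (\<phi>\<^sup>2 - Q\<^sup>2) / 2
      + s * (P\<^sup>2 - \<psi>\<^sup>2) / 2 + (\<phi> ^ 3 / 3 + (- (\<psi> * \<phi>\<^sup>2)) / 2 + \<psi> * \<phi> ^ 3 / 3 + s * \<psi> ^ 3 / 6)"
    by (simp add: field_simps power2_eq_square power3_eq_cube)
  also have "\<dots> \<le> \<phi> - s * \<psi> + (P * Q - Q\<^sup>2 / 2 - s * P\<^sup>2 / 2) + 4 * u * D\<^sup>2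
      + (D ^ 3 / 3 + D ^ 3 / 2 + A * D ^ 3 / 3 + D ^ 3 / 6)"
  proof -
    have "B + X1 - X2 / 2 + X3 / 2 + (Y1 / 3 + Y2 / 2 + Y3 / 3 + Y4 / 6) \<le> B + 4 * u * D\<^sup>2 + (d / 3 + d / 2 + d' / 3 + d / 6)"
      if "\<bar>X1\<bar> \<le> 2 * u * D\<^sup>2" "\<bar>X2\<bar> \<le> 2 * u * D\<^sup>2" "X3 \<le> 2 * u * D\<^sup>2" "Y1 \<le> d" "Y2 \<le> d" "Y3 \<le> d'" "Y4 \<le> d"
      for B X1 X2 X3 Y1 Y2 Y3 Y4 d d' :: real
      using that by (simp add: abs_le_iff)
    from this[OF q1 q2 q3 c1 c2 c3 c4] show ?thesis .
  qed
  also have "\<dots> \<le> \<phi> - s * \<psi> + (P * Q - Q\<^sup>2 / 2 - s * P\<^sup>2 / 2) + 4 * u * D\<^sup>2 + D ^ 3 * (1 + A)"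
    using AD by (simp add: algebra_simps)
  finally show ?thesis using 1 2 by linarith
qed

text \<open>Dividing by the reference values \<open>G\<close> and \<open>F\<close> reduces this to
  \<open>entropy_taylor\<close> with \<open>D = u * S / c\<close> and \<open>A = C / c\<close>. The
  part linear in \<open>g - G\<close> and \<open>f - F\<close> is kept exact, because it integrates
  to zero once \<open>G\<close> and \<open>F\<close> are the means.\<close>

lemma entropy_taylor_bounded:
  fixes g f G F :: real
  assumes c: "0 < c" "c \<le> g" "g \<le> C" "c \<le> f" "f \<le> C" "c \<le> G" "G \<le> C" "c \<le> F" "F \<le> C"
    and s: "0 \<le> s" "s \<le> 1" and u: "0 \<le> u"
    and b: "\<bar>g - G\<bar> \<le> u * S" "\<bar>f - F\<bar> \<le> u * S" "\<bar>p\<bar> \<le> S" "\<bar>q\<bar> \<le> S"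
      "\<bar>g - G - u * p\<bar> \<le> u\<^sup>2 * S" "\<bar>f - F - u * q\<bar> \<le> u\<^sup>2 * S"
  shows "g * ln f - s * (g * ln g) \<le> (G * ln F - s * (G * ln G))
    + ((g - G) * (ln F - s * ln G - s) + (f - F) * (G / F))
    + G * u\<^sup>2 * (p * q / (G * F) - q\<^sup>2 / (2 * F\<^sup>2) - s * p\<^sup>2 / (2 * G\<^sup>2))
    + u ^ 3 * (C * (4 * S\<^sup>2 / c\<^sup>2 + S ^ 3 / c ^ 3 * (1 + C / c)))"
proof -
  have pos: "0 < g" "0 < f" "0 < G" "0 < F" using c by linarith+
  have S: "0 \<le> S" using b by linarith
  define \<psi> where "\<psi> = (g - G) / G"
  define \<phi> where "\<phi> = (f - F) / F"
  define D where "D = u * S / c"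
  have bd: "\<bar>x / y\<bar> \<le> B / c" if "\<bar>x\<bar> \<le> B" "c \<le> y" for x y B :: real
  proof -
    have "\<bar>x / y\<bar> = \<bar>x\<bar> / y" using that c by simp
    also have "\<dots> \<le> B / c" using that c by (intro frac_le) auto
    finally show ?thesis .
  qed
  have g: "g = G * (1 + \<psi>)" and f: "f = F * (1 + \<phi>)"
    using pos by (auto simp: \<psi>_def \<phi>_def field_simps)
  have l1: "-1 < \<psi>" "-1 < \<phi>" using pos by (auto simp: \<psi>_def \<phi>_def field_simps)
  have tay: "(1 + \<psi>) * ln (1 + \<phi>) - s * ((1 + \<psi>) * ln (1 + \<psi>))
     \<le> \<phi> - s * \<psi> + ((u * p / G) * (u * q / F) - (u * q / F)\<^sup>2 / 2 - s * (u * p / G)\<^sup>2 / 2)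
        + 4 * u * D\<^sup>2 + D ^ 3 * (1 + C / c)"
  proof (rule entropy_taylor[OF l1 s u])
    have up: "\<bar>u * p\<bar> \<le> u * S" "\<bar>u * q\<bar> \<le> u * S"
      using b u by (auto simp: abs_mult intro!: mult_left_mono)
    show "\<bar>\<psi>\<bar> \<le> D" "\<bar>\<phi>\<bar> \<le> D" "\<bar>u * p / G\<bar> \<le> D" "\<bar>u * q / F\<bar> \<le> D"
      unfolding \<psi>_def \<phi>_def D_def using bd[OF b(1) c(6)] bd[OF b(2) c(8)] bd[OF up(1) c(6)] bd[OF up(2) c(8)] by simp_all
    have "\<bar>(g - G - u * p) / G\<bar> \<le> u\<^sup>2 * S / c" "\<bar>(f - F - u * q) / F\<bar> \<le> u\<^sup>2 * S / c"
      using bd[OF b(5) c(6)] bd[OF b(6) c(8)] by simp_all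
    then show "\<bar>\<psi> - u * p / G\<bar> \<le> u * D" "\<bar>\<phi> - u * q / F\<bar> \<le> u * D"
      unfolding \<psi>_def \<phi>_def D_def by (simp_all add: diff_divide_distrib power2_eq_square)
    have "\<bar>g - G\<bar> \<le> C" using c by linarith
    then show "\<bar>\<psi>\<bar> \<le> C / c"
      unfolding \<psi>_def by (rule bd) (rule c(6))
  qed
  have "4 * u * D\<^sup>2 + D ^ 3 * (1 + C / c) = u ^ 3 * (4 * S\<^sup>2 / c\<^sup>2 + S ^ 3 / c ^ 3 * (1 + C / c))"
    unfolding D_def using c by (simp add: power_mult_distrib power_divide power2_eq_square power3_eq_cube field_simps)
  then have main: "(1 + \<psi>) * ln (1 + \<phi>) - s * ((1 + \<psi>) * ln (1 + \<psi>))
     \<le> \<phi> - s * \<psi> + ((u * p / G) * (u * q / F) - (u * q / F)\<^sup>2 / 2 - s * (u * p / G)\<^sup>2 / 2)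
        + u ^ 3 * (4 * S\<^sup>2 / c\<^sup>2 + S ^ 3 / c ^ 3 * (1 + C / c))"
    using tay by (simp add: add.assoc)
  have "ln f = ln F + ln (1 + \<phi>)" "ln g = ln G + ln (1 + \<psi>)"
    unfolding f g using pos l1 by (auto simp: ln_mult)
  then have "g * ln f - s * (g * ln g) = g * ln F - s * (g * ln G)
      + G * ((1 + \<psi>) * ln (1 + \<phi>) - s * ((1 + \<psi>) * ln (1 + \<psi>)))"
    by (simp add: g algebra_simps)
  also have "\<dots> \<le> g * ln F - s * (g * ln G) + G * (\<phi> - s * \<psi> + ((u * p / G) * (u * q / F) - (u * q / F)\<^sup>2 / 2 - s * (u * p / G)\<^sup>2 / 2)
        + u ^ 3 * (4 * S\<^sup>2 / c\<^sup>2 + S ^ 3 / c ^ 3 * (1 + C / c)))"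
    using main pos by (intro add_left_mono mult_left_mono) auto
  also have "\<dots> = g * ln F - s * (g * ln G) + (f - F) * (G / F) - s * (g - G)
    + G * u\<^sup>2 * (p * q / (G * F) - q\<^sup>2 / (2 * F\<^sup>2) - s * p\<^sup>2 / (2 * G\<^sup>2))
    + G * (u ^ 3 * (4 * S\<^sup>2 / c\<^sup>2 + S ^ 3 / c ^ 3 * (1 + C / c)))"
  proof -
    have a: "G * \<phi> = (f - F) * (G / F)" "G * \<psi> = g - G"
      using pos by (auto simp: \<psi>_def \<phi>_def)
    have b: "(u * p / G) * (u * q / F) - (u * q / F)\<^sup>2 / 2 - s * (u * p / G)\<^sup>2 / 2
      = u\<^sup>2 * (p * q / (G * F) - q\<^sup>2 / (2 * F\<^sup>2) - s * p\<^sup>2 / (2 * G\<^sup>2))"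
      by (simp add: power_mult_distrib power_divide power2_eq_square right_diff_distrib ac_simps)
    have "G * (\<phi> - s * \<psi> + X + Y) = G * \<phi> - s * (G * \<psi>) + G * X + G * Y" for X Y
      by (simp add: algebra_simps)
    then show ?thesis unfolding b by (simp only: a mult.assoc)
  qed
  also have "G * (u ^ 3 * (4 * S\<^sup>2 / c\<^sup>2 + S ^ 3 / c ^ 3 * (1 + C / c)))
      \<le> C * (u ^ 3 * (4 * S\<^sup>2 / c\<^sup>2 + S ^ 3 / c ^ 3 * (1 + C / c)))"
    using c u S by (intro mult_right_mono) auto
  finally show ?thesis by (simp add: algebra_simps)
qed

text \<open>The expansions are given around \<open>g0\<close> and \<open>f0\<close>, but the linear
  terms cancel only around the means; recentring turns the majorant \<open>T\<close> into
  \<open>2 * T x + expectation T\<close>. The hypothesis \<open>cov\<close> makes the mean of the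
  quadratic term nonpositive, leaving an error of order \<open>u ^ 3\<close>.\<close>

lemma (in prob_space) entropy_local_step:
  fixes g f p q T :: "'a \<Rightarrow> real"
  assumes [measurable]: "g \<in> borel_measurable M" "f \<in> borel_measurable M"
      "p \<in> borel_measurable M" "q \<in> borel_measurable M" "T \<in> borel_measurable M"
    and c: "0 < c" "\<And>x. c \<le> g x" "\<And>x. g x \<le> C" "\<And>x. c \<le> f x" "\<And>x. f x \<le> C"
    and s: "0 \<le> s" "s \<le> 1" and u: "0 \<le> u" "u \<le> 1"
    and T: "\<And>x. 1 \<le> T x" "integrable M (\<lambda>x. T x ^ 3)"
    and pq: "\<And>x. \<bar>p x\<bar> \<le> T x" "\<And>x. \<bar>q x\<bar> \<le> T x"
    and lin: "\<And>x. \<bar>g x - g0 - u * p x\<bar> \<le> u\<^sup>2 * T x" "\<And>x. \<bar>f x - f0 - u * q x\<bar> \<le> u\<^sup>2 * T x"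
    and mean: "expectation p = 0" "expectation q = 0"
    and cov: "\<And>k. 2 * k * expectation (\<lambda>x. p x * q x)
        \<le> expectation (\<lambda>x. (q x)\<^sup>2) + s * k\<^sup>2 * expectation (\<lambda>x. (p x)\<^sup>2)"
  shows "expectation (\<lambda>x. g x * ln (f x) - s * (g x * ln (g x)))
     \<le> expectation g * ln (expectation f) - s * (expectation g * ln (expectation g))
      + u ^ 3 * (C * expectation (\<lambda>x. 4 * (2 * T x + expectation T)\<^sup>2 / c\<^sup>2
          + (2 * T x + expectation T) ^ 3 / c ^ 3 * (1 + C / c)))"
proof -
  define G where "G = expectation g"
  define F where "F = expectation f"
  define m where "m = expectation T"
  define S where "S x = 2 * T x + m" for x
  have intT2: "integrable M (\<lambda>x. (T x)\<^sup>2)"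
  proof (rule Bochner_Integration.integrable_bound[OF T(2)])
    show "AE x in M. norm ((T x)\<^sup>2) \<le> norm (T x ^ 3)"
      using T(1) by (intro AE_I2) (auto intro!: power_increasing simp: abs_of_nonneg order.trans[OF zero_le_one])
  qed measurable
  have intT: "integrable M T"
  proof (rule Bochner_Integration.integrable_bound[OF intT2])
    show "AE x in M. norm (T x) \<le> norm ((T x)\<^sup>2)"
    proof (intro AE_I2)
      fix x
      have "T x * 1 \<le> T x * T x" using T(1)[of x] by (intro mult_left_mono) auto
      then show "norm (T x) \<le> norm ((T x)\<^sup>2)"
        using T(1)[of x] by (simp add: power2_eq_square)
    qed
  qed measurable
  have bint: "integrable M v" if [measurable]: "v \<in> borel_measurable M" and "\<And>x. \<bar>v x\<bar> \<le> B" for v :: "'a \<Rightarrow> real" and B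
    using that by (intro integrable_const_bound[of _ B]) auto
  have C: "c \<le> C" using c(2,3) order.trans by blast
  have ig: "integrable M g" and if': "integrable M f"
    using bint[of g C] bint[of f C] c by (simp_all add: abs_of_nonneg order.trans[OF less_imp_le])
  have ip: "integrable M p" and iq: "integrable M q"
    by (auto intro!: Bochner_Integration.integrable_bound[OF intT] AE_I2 order.trans[OF pq(1)] order.trans[OF pq(2)])
  have ipq: "integrable M (\<lambda>x. v x * w x)"
    if [measurable]: "v \<in> borel_measurable M" "w \<in> borel_measurable M" and "\<And>x. \<bar>v x\<bar> \<le> T x" "\<And>x. \<bar>w x\<bar> \<le> T x" for v w
  proof (rule Bochner_Integration.integrable_bound[OF intT2])
    have "\<bar>v x\<bar> * \<bar>w x\<bar> \<le> T x * T x" for x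
      using that(3,4)[of x] by (intro mult_mono) auto
    then show "AE x in M. norm (v x * w x) \<le> norm ((T x)\<^sup>2)"
      by (intro AE_I2) (simp add: abs_mult power2_eq_square)
  qed measurable
  have m: "1 \<le> m"
    unfolding m_def using integral_mono[of M "\<lambda>_. 1" T] intT T(1) by (simp add: prob_space)
  have Gc: "c \<le> G" "G \<le> C" "c \<le> F" "F \<le> C"
    using integral_mono[of M "\<lambda>_. c" g] integral_mono[of M g "\<lambda>_. C"]
      integral_mono[of M "\<lambda>_. c" f] integral_mono[of M f "\<lambda>_. C"] ig if' c
    by (auto simp: G_def F_def prob_space)
  \<comment> \<open>As \<open>w\<close> has mean zero, the mean of \<open>v\<close> differs from
    \<open>v0\<close> only to second order in \<open>u\<close>, so the same slopes serve after
    recentring.\<close>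
  have shift: "\<bar>expectation v - v0\<bar> \<le> u\<^sup>2 * m"
    if "integrable M v" "integrable M w" "expectation w = 0" "\<And>x. \<bar>v x - v0 - u * w x\<bar> \<le> u\<^sup>2 * T x" for v w v0
  proof -
    have "expectation v - v0 = expectation (\<lambda>x. v x - v0 - u * w x)"
      using that by (simp add: prob_space)
    also have "\<bar>\<dots>\<bar> \<le> expectation (\<lambda>x. \<bar>v x - v0 - u * w x\<bar>)"
      by (rule integral_abs_bound)
    also have "\<dots> \<le> expectation (\<lambda>x. u\<^sup>2 * T x)"
      using that intT by (intro integral_mono) auto
    finally show ?thesis by (simp add: m_def)
  qed
  have sh: "\<bar>G - g0\<bar> \<le> u\<^sup>2 * m" "\<bar>F - f0\<bar> \<le> u\<^sup>2 * m"
    unfolding G_def F_def using shift[OF ig ip mean(1) lin(1)] shift[OF if' iq mean(2) lin(2)] by auto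
  have uu: "u\<^sup>2 \<le> u" using u by (simp add: power2_eq_square mult_left_le)
  have b2: "\<bar>a - A - u * w\<bar> \<le> u\<^sup>2 * S x" "\<bar>a - A\<bar> \<le> u * S x"
    if "\<bar>A - a0\<bar> \<le> u\<^sup>2 * m" "\<bar>a - a0 - u * w\<bar> \<le> u\<^sup>2 * T x" "\<bar>w\<bar> \<le> T x" for a A a0 w x
  proof -
    have "\<bar>a - A - u * w\<bar> \<le> u\<^sup>2 * T x + u\<^sup>2 * m" using that by linarith
    then have 1: "\<bar>a - A - u * w\<bar> \<le> u\<^sup>2 * (T x + m)" by (simp add: algebra_simps)
    also have "\<dots> \<le> u\<^sup>2 * S x" using T(1)[of x] unfolding S_def by (intro mult_left_mono) auto
    finally show "\<bar>a - A - u * w\<bar> \<le> u\<^sup>2 * S x" .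
    have "u\<^sup>2 * (T x + m) \<le> u * (T x + m)" using uu T(1)[of x] m by (intro mult_right_mono) auto
    moreover have "\<bar>u * w\<bar> \<le> u * T x" using that u by (auto simp: abs_mult intro!: mult_left_mono)
    ultimately show "\<bar>a - A\<bar> \<le> u * S x"
      using 1 unfolding S_def by (simp add: algebra_simps)
  qed
  have TS: "T x \<le> S x" for x using T(1)[of x] m by (simp add: S_def)
  define R where "R x = 4 * (S x)\<^sup>2 / c\<^sup>2 + S x ^ 3 / c ^ 3 * (1 + C / c)" for x
  have iS2: "integrable M (\<lambda>x. (S x)\<^sup>2)"
    unfolding S_def power2_sum using intT intT2 by (simp add: power_mult_distrib)
  have iS3: "integrable M (\<lambda>x. S x ^ 3)"
  proof -
    have "S x ^ 3 = 8 * T x ^ 3 + 12 * m * (T x)\<^sup>2 + 6 * m\<^sup>2 * T x + m ^ 3" for x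
      unfolding S_def by (simp add: power3_eq_cube power2_eq_square algebra_simps)
    then show ?thesis using intT intT2 T(2) by simp
  qed
  have iR: "integrable M R" unfolding R_def using iS2 iS3 by auto
  have pt: "g x * ln (f x) - s * (g x * ln (g x)) \<le> (G * ln F - s * (G * ln G))
    + ((g x - G) * (ln F - s * ln G - s) + (f x - F) * (G / F))
    + G * u\<^sup>2 * (p x * q x / (G * F) - (q x)\<^sup>2 / (2 * F\<^sup>2) - s * (p x)\<^sup>2 / (2 * G\<^sup>2))
    + u ^ 3 * (C * R x)" for x
    unfolding R_def
    using c Gc s u pq[of x] TS[of x] b2[OF sh(1) lin(1)[of x] pq(1)[of x]] b2[OF sh(2) lin(2)[of x] pq(2)[of x]]
    by (intro entropy_taylor_bounded) auto
  have lnb: "\<bar>ln y\<bar> \<le> \<bar>ln c\<bar> + \<bar>ln C\<bar>" if "c \<le> y" "y \<le> C" for y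
  proof -
    have "ln c \<le> ln y" "ln y \<le> ln C" using that c by (auto intro!: ln_mono)
    then show ?thesis by linarith
  qed
  have gb: "\<bar>g x\<bar> \<le> C" for x using c(2,3)[of x] c(1) by simp
  have "expectation (\<lambda>x. g x * ln (f x) - s * (g x * ln (g x))) \<le>
    expectation (\<lambda>x. (G * ln F - s * (G * ln G))
    + ((g x - G) * (ln F - s * ln G - s) + (f x - F) * (G / F))
    + G * u\<^sup>2 * (p x * q x / (G * F) - (q x)\<^sup>2 / (2 * F\<^sup>2) - s * (p x)\<^sup>2 / (2 * G\<^sup>2))
    + u ^ 3 * (C * R x))"
  proof (rule integral_mono[OF _ _ pt])
    have "\<bar>g x * ln (f x)\<bar> \<le> C * (\<bar>ln c\<bar> + \<bar>ln C\<bar>)" "\<bar>g x * ln (g x)\<bar> \<le> C * (\<bar>ln c\<bar> + \<bar>ln C\<bar>)" for x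
      unfolding abs_mult using gb lnb c C by (auto intro!: mult_mono)
    then show "integrable M (\<lambda>x. g x * ln (f x) - s * (g x * ln (g x)))"
      by (intro Bochner_Integration.integrable_diff integrable_mult_right) (auto intro!: bint)
    show "integrable M (\<lambda>x. (G * ln F - s * (G * ln G))
    + ((g x - G) * (ln F - s * ln G - s) + (f x - F) * (G / F))
    + G * u\<^sup>2 * (p x * q x / (G * F) - (q x)\<^sup>2 / (2 * F\<^sup>2) - s * (p x)\<^sup>2 / (2 * G\<^sup>2))
    + u ^ 3 * (C * R x))"
      using ig if' iR ipq[of p q] ipq[of p p] ipq[of q q] pq by (simp add: power2_eq_square)
  qed
  also have "\<dots> = (G * ln F - s * (G * ln G))
     + G * u\<^sup>2 * (expectation (\<lambda>x. p x * q x) / (G * F) - expectation (\<lambda>x. (q x)\<^sup>2) / (2 * F\<^sup>2)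
        - s * expectation (\<lambda>x. (p x)\<^sup>2) / (2 * G\<^sup>2)) + u ^ 3 * (C * expectation R)"
    using ig if' iR ipq[of p q] ipq[of p p] ipq[of q q] pq
    by (simp add: power2_eq_square prob_space G_def[symmetric] F_def[symmetric])
  also have "\<dots> \<le> (G * ln F - s * (G * ln G)) + G * u\<^sup>2 * 0 + u ^ 3 * (C * expectation R)"
  proof (intro add_mono mult_left_mono order.refl)
    have pos: "0 < G" "0 < F" using Gc c by auto
    \<comment> \<open>Clearing the factor \<open>2 * F\<^sup>2\<close> leaves the covariance
      inequality with \<open>k = F / G\<close>.\<close>
    have "expectation (\<lambda>x. p x * q x) / (G * F) - expectation (\<lambda>x. (q x)\<^sup>2) / (2 * F\<^sup>2)
        - s * expectation (\<lambda>x. (p x)\<^sup>2) / (2 * G\<^sup>2)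
      = (2 * (F / G) * expectation (\<lambda>x. p x * q x) - (expectation (\<lambda>x. (q x)\<^sup>2)
         + s * (F / G)\<^sup>2 * expectation (\<lambda>x. (p x)\<^sup>2))) / (2 * F\<^sup>2)"
      using pos by (simp add: divide_simps power2_eq_square) (simp add: algebra_simps)
    also have "\<dots> \<le> 0"
      using cov[of "F / G"] by (intro divide_nonpos_nonneg) auto
    finally show "expectation (\<lambda>x. p x * q x) / (G * F) - expectation (\<lambda>x. (q x)\<^sup>2) / (2 * F\<^sup>2)
        - s * expectation (\<lambda>x. (p x)\<^sup>2) / (2 * G\<^sup>2) \<le> 0" .
    show "0 \<le> G * u\<^sup>2" using pos by simp
  qed (use c C u in auto)
  finally show ?thesis
    unfolding G_def[symmetric] F_def[symmetric] m_def[symmetric] R_def S_def by simp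
qed

subsection \<open>Gaussian smoothing\<close>

lemma measure_std_gauss_UNIV [simp]: "measure std_gauss UNIV = 1"
  using std_gauss.prob_space by simp

lemma integrable_std_gauss_bounded:
  fixes h :: "'a::euclidean_space \<Rightarrow> real"
  assumes "h \<in> borel_measurable borel" and "\<And>x. \<bar>h x\<bar> \<le> B"
  shows "integrable std_gauss h"
  using assms by (intro std_gauss.integrable_const_bound[of _ B]) auto

text \<open>Dividing by \<open>\<sigma> + \<tau>\<close> turns the two coefficients into a cosine
  and a sine, so rotation invariance applies.\<close>

lemma integral_std_gauss_add:
  fixes h :: "'a::euclidean_space \<Rightarrow> real"
  assumes [measurable]: "h \<in> borel_measurable borel" and bd: "\<And>x. \<bar>h x\<bar> \<le> B"
    and st: "0 \<le> \<sigma>" "0 \<le> \<tau>"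
  shows "(\<integral>x. h (sqrt (\<sigma> + \<tau>) *\<^sub>R x) \<partial>std_gauss)
    = (\<integral>x. (\<integral>y. h (sqrt \<sigma> *\<^sub>R x + sqrt \<tau> *\<^sub>R y) \<partial>std_gauss) \<partial>std_gauss)"
proof (cases "\<sigma> + \<tau> = 0")
  case True
  then have "\<sigma> = 0" "\<tau> = 0" using st by auto
  then show ?thesis by simp
next
  case False
  define \<rho> where "\<rho> = \<sigma> + \<tau>"
  define c where "c = sqrt (\<sigma> / \<rho>)"
  define s where "s = sqrt (\<tau> / \<rho>)"
  have \<rho>: "0 < \<rho>" using False st by (simp add: \<rho>_def)
  have cs: "c\<^sup>2 + s\<^sup>2 = 1"
    using \<rho> st by (simp add: c_def s_def \<rho>_def flip: add_divide_distrib)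
  have sc: "sqrt \<rho> * c = sqrt \<sigma>" "sqrt \<rho> * s = sqrt \<tau>"
    using \<rho> st by (auto simp: c_def s_def simp flip: real_sqrt_mult)
  let ?r = "\<lambda>z::'a \<times> 'a. c *\<^sub>R fst z + s *\<^sub>R snd z"
  have "(\<integral>x. h (sqrt \<rho> *\<^sub>R x) \<partial>std_gauss) = (\<integral>x. h (sqrt \<rho> *\<^sub>R x) \<partial>distr std_gauss borel ?r)"
    by (simp add: distr_std_gauss_rotate[OF cs])
  also have "\<dots> = (\<integral>z. h (sqrt \<rho> *\<^sub>R ?r z) \<partial>std_gauss)"
    by (subst integral_distr) (auto simp: measurable_cong_sets[OF sets_std_gauss refl] borel_measurable_rotate)
  also have "\<dots> = (\<integral>z. h (sqrt \<sigma> *\<^sub>R fst z + sqrt \<tau> *\<^sub>R snd z) \<partial>(std_gauss \<Otimes>\<^sub>M std_gauss))"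
    by (simp add: std_gauss_prod scaleR_add_right sc)
  also have "\<dots> = (\<integral>x. (\<integral>y. h (sqrt \<sigma> *\<^sub>R x + sqrt \<tau> *\<^sub>R y) \<partial>std_gauss) \<partial>std_gauss)"
  proof (subst std_gauss_pair.integral_fst'[symmetric])
    show "integrable (std_gauss \<Otimes>\<^sub>M std_gauss) (\<lambda>z::'a\<times>'a. h (sqrt \<sigma> *\<^sub>R fst z + sqrt \<tau> *\<^sub>R snd z))"
      unfolding std_gauss_prod
      by (rule integrable_std_gauss_bounded[OF measurable_compose[OF borel_measurable_rotate assms(1)] bd])
  qed simp
  finally show ?thesis by (simp add: \<rho>_def)
qed

text \<open>For \<open>\<sigma> \<ge> 0\<close> this is convolution with the centred Gaussian of
  variance \<open>\<sigma>\<close> in each coordinate: the heat semigroup with generator half the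
  Laplacian at time \<open>\<sigma>\<close>.\<close>

definition gauss_smooth :: "real \<Rightarrow> ('a::euclidean_space \<Rightarrow> real) \<Rightarrow> 'a \<Rightarrow> real" where
  "gauss_smooth \<sigma> h x = (\<integral>z. h (x + sqrt \<sigma> *\<^sub>R z) \<partial>std_gauss)"

lemma borel_measurable_gauss_smooth [measurable]:
  assumes [measurable]: "h \<in> borel_measurable borel"
  shows "gauss_smooth \<sigma> h \<in> borel_measurable borel"
  unfolding gauss_smooth_def by measurable

lemma gauss_smooth_bounds:
  assumes [measurable]: "h \<in> borel_measurable borel" and h: "\<And>x. c \<le> h x" "\<And>x. h x \<le> C"
  shows "c \<le> gauss_smooth \<sigma> h x" and "gauss_smooth \<sigma> h x \<le> C"
proof -
  have i: "integrable std_gauss (\<lambda>z. h (x + sqrt \<sigma> *\<^sub>R z))"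
  proof (rule integrable_std_gauss_bounded)
    show "\<bar>h (x + sqrt \<sigma> *\<^sub>R z)\<bar> \<le> \<bar>c\<bar> + \<bar>C\<bar>" for z
      using h[of "x + sqrt \<sigma> *\<^sub>R z"] by linarith
  qed measurable
  show "c \<le> gauss_smooth \<sigma> h x"
    using integral_mono[OF std_gauss.integrable_const[of c] i h(1)]
    by (simp add: gauss_smooth_def)
  show "gauss_smooth \<sigma> h x \<le> C"
    using integral_mono[OF i std_gauss.integrable_const[of C] h(2)]
    by (simp add: gauss_smooth_def)
qed

lemma gauss_smooth_add:
  fixes h :: "'a::euclidean_space \<Rightarrow> real"
  assumes [measurable]: "h \<in> borel_measurable borel" and bd: "\<And>x. \<bar>h x\<bar> \<le> B"
    and st: "0 \<le> \<sigma>" "0 \<le> \<tau>"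
  shows "gauss_smooth (\<sigma> + \<tau>) h x = gauss_smooth \<tau> (gauss_smooth \<sigma> h) x"
  unfolding gauss_smooth_def
  using integral_std_gauss_add[of "\<lambda>y. h (x + y)" B \<tau> \<sigma>] bd st
  by (simp add: add.assoc add.commute[of \<tau>])

section \<open>Cameron-Martin formula and expansion of the heat semigroup\<close>

lemma exp_minus_linear_le: "\<bar>exp x - 1 - x\<bar> \<le> x\<^sup>2 * exp \<bar>x\<bar>" for x :: real
proof -
  have ge: "exp x \<ge> 1 + x" by (rule exp_ge_add_one_self)
  have "(1 - x) * exp x \<le> exp (- x) * exp x"
    using exp_ge_add_one_self[of "- x"] by (intro mult_right_mono) auto
  then have 1: "exp x - 1 \<le> x * exp x"
    by (simp add: algebra_simps flip: exp_add)
  have "x * (exp x - 1) \<le> x\<^sup>2 * exp \<bar>x\<bar>"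
  proof (cases "0 \<le> x")
    case True
    then have "x * (exp x - 1) \<le> x * (x * exp x)" using 1 by (intro mult_left_mono) auto
    then show ?thesis using True by (simp add: power2_eq_square)
  next
    case False
    then have "x * (exp x - 1) \<le> x * x"
      using ge by (intro mult_left_mono_neg) linarith+
    also have "\<dots> \<le> x * x * exp \<bar>x\<bar>" by (simp add: mult_le_cancel_left1)
    finally show ?thesis by (simp add: power2_eq_square)
  qed
  moreover have "exp x - 1 - x \<le> x * (exp x - 1)" using 1 by (simp add: algebra_simps)
  ultimately show ?thesis using ge by linarith
qed

text \<open>Moves a translation from the argument of \<open>h\<close> to the Gaussian weight, where
  it can be expanded although \<open>h\<close> is merely measurable.\<close>

lemma cameron_martin:
  fixes h :: "'a::euclidean_space \<Rightarrow> real"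
  assumes [measurable]: "h \<in> borel_measurable borel"
  shows "(\<integral>z. h (z + w) \<partial>std_gauss) = (\<integral>z. exp (z \<bullet> w - (norm w)\<^sup>2 / 2) * h z \<partial>std_gauss)"
    and "integrable std_gauss (\<lambda>z. h (z + w)) \<longleftrightarrow>
      integrable std_gauss (\<lambda>z. exp (z \<bullet> w - (norm w)\<^sup>2 / 2) * h z)"
proof -
  have "(\<integral>z. h (z + w) \<partial>std_gauss) = (\<integral>z. h z \<partial>distr std_gauss borel (\<lambda>z. z + w))"
    by (subst integral_distr) auto
  then show "(\<integral>z. h (z + w) \<partial>std_gauss) = (\<integral>z. exp (z \<bullet> w - (norm w)\<^sup>2 / 2) * h z \<partial>std_gauss)"
    unfolding distr_std_gauss_shift by (subst (asm) integral_density) auto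
  have "integrable std_gauss (\<lambda>z. h (z + w)) = integrable (distr std_gauss borel (\<lambda>z. z + w)) h"
    by (subst integrable_distr_eq) auto
  then show "integrable std_gauss (\<lambda>z. h (z + w)) \<longleftrightarrow>
      integrable std_gauss (\<lambda>z. exp (z \<bullet> w - (norm w)\<^sup>2 / 2) * h z)"
    unfolding distr_std_gauss_shift by (subst (asm) integrable_density) auto
qed

lemma integral_cameron_martin_density:
  "integrable std_gauss (\<lambda>z::'a::euclidean_space. exp (z \<bullet> w - (norm w)\<^sup>2 / 2))"
  "(\<integral>z. exp (z \<bullet> (w::'a) - (norm w)\<^sup>2 / 2) \<partial>std_gauss) = 1"
  using cameron_martin[of "\<lambda>_. 1" w] std_gauss.prob_space by simp_all

text \<open>First-order expansion in L1 of the translated Gaussian density. It has to hold for all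
  \<open>w\<close>, because the displacements later inserted are themselves Gaussian and hence
  unbounded.\<close>

lemma cameron_martin_remainder:
  "\<exists>K\<ge>0. \<forall>w::'a::euclidean_space.
     (\<integral>z. \<bar>exp (z \<bullet> w - (norm w)\<^sup>2 / 2) - 1 - z \<bullet> w\<bar> \<partial>std_gauss) \<le> K * (norm w)\<^sup>2"
proof -
  define m where "m = (\<integral>z. norm (z::'a) \<partial>std_gauss)"
  define E where "E = (\<integral>z. exp (3 * norm (z::'a)) \<partial>std_gauss)"
  have m: "0 \<le> m" "0 \<le> E" by (simp_all add: m_def E_def)
  have li: "integrable std_gauss (\<lambda>z::'a. z \<bullet> w)" for w
    by (rule Bochner_Integration.integrable_bound[OF integrable_mult_left[OF integrable_std_gauss_norm, of "norm w"]])
      (auto intro!: AE_I2 Cauchy_Schwarz_ineq2)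
  have int: "integrable std_gauss (\<lambda>z::'a. \<bar>exp (z \<bullet> w - (norm w)\<^sup>2 / 2) - 1 - z \<bullet> w\<bar>)" for w
    using li[of w] integral_cameron_martin_density(1)[of w] by auto
  define K where "K = 2 + m + (exp 1 * E + 1)"
  have "(\<integral>z. \<bar>exp (z \<bullet> w - (norm w)\<^sup>2 / 2) - 1 - z \<bullet> w\<bar> \<partial>std_gauss) \<le> K * (norm w)\<^sup>2" for w :: 'a
  proof (cases "norm w \<le> 1")
    case True
    have "(\<integral>z. \<bar>exp (z \<bullet> w - (norm w)\<^sup>2 / 2) - 1 - z \<bullet> w\<bar> \<partial>std_gauss)
        \<le> (\<integral>z. (norm w)\<^sup>2 * (exp 1 * exp (3 * norm (z::'a)) + 1) \<partial>std_gauss)"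
    proof (rule integral_mono[OF int])
      fix z :: 'a
      \<comment> \<open>The deviation \<open>(norm w)\<^sup>2 / 2\<close> of \<open>\<theta>\<close>
        from \<open>z \<bullet> w\<close> is covered by the summand 1 in the majorant. Of the three
        factors \<open>exp (norm z)\<close> there, two come from \<open>\<theta>\<^sup>2\<close> and
        one from \<open>exp \<bar>\<theta>\<bar>\<close>.\<close>
      define \<theta> where "\<theta> = z \<bullet> w - (norm w)\<^sup>2 / 2"
      have ww: "(norm w)\<^sup>2 \<le> norm w" using True by (simp add: power2_eq_square mult_left_le)
      have "\<bar>\<theta>\<bar> \<le> norm z * norm w + (norm w)\<^sup>2 / 2"
        unfolding \<theta>_def using Cauchy_Schwarz_ineq2[of z w] zero_le_power2[of "norm w"] by linarith
      also have "\<dots> \<le> norm w * (1 + norm z)" using ww norm_ge_zero[of w] mult.commute[of "norm z" "norm w"]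
        unfolding distrib_left by linarith
      finally have t1: "\<bar>\<theta>\<bar> \<le> norm w * (1 + norm z)" .
      also have "\<dots> \<le> 1 * (1 + norm z)" using True by (intro mult_right_mono) auto
      finally have t2: "\<bar>\<theta>\<bar> \<le> 1 + norm z" by simp
      have "norm w * (1 + norm z) \<le> norm w * exp (norm z)"
        by (intro mult_left_mono exp_ge_add_one_self) auto
      with t1 have t3: "\<bar>\<theta>\<bar> \<le> norm w * exp (norm z)" by linarith
      have "\<theta>\<^sup>2 * exp \<bar>\<theta>\<bar> \<le> (norm w * exp (norm z))\<^sup>2 * exp (1 + norm z)"
        using t2 power_mono[OF t3, of 2] by (intro mult_mono) auto
      also have "\<dots> = (norm w)\<^sup>2 * (exp 1 * exp (3 * norm z))"
        by (simp add: power_mult_distrib power2_eq_square mult.assoc flip: exp_add)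
      finally have "\<bar>exp \<theta> - 1 - \<theta>\<bar> \<le> (norm w)\<^sup>2 * (exp 1 * exp (3 * norm z))"
        using exp_minus_linear_le[of \<theta>] by linarith
      then show "\<bar>exp (z \<bullet> w - (norm w)\<^sup>2 / 2) - 1 - z \<bullet> w\<bar> \<le> (norm w)\<^sup>2 * (exp 1 * exp (3 * norm z) + 1)"
        using zero_le_power2[of "norm w"] unfolding \<theta>_def distrib_left mult_1_right by linarith
    qed (auto simp: integrable_std_gauss_exp_norm)
    also have "\<dots> = (norm w)\<^sup>2 * (exp 1 * E + 1)"
      using std_gauss.prob_space[where 'a='a] integrable_std_gauss_exp_norm[of 3, where 'a='a] by (simp add: E_def)
    also have "\<dots> \<le> (norm w)\<^sup>2 * K" using m by (intro mult_left_mono) (auto simp: K_def)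
    finally show ?thesis by (simp add: mult.commute)
  next
    case False
    have "(\<integral>z. \<bar>exp (z \<bullet> w - (norm w)\<^sup>2 / 2) - 1 - z \<bullet> w\<bar> \<partial>std_gauss)
        \<le> (\<integral>z. exp (z \<bullet> w - (norm w)\<^sup>2 / 2) + 1 + norm z * norm w \<partial>std_gauss)"
    proof (rule integral_mono[OF int])
      show "\<bar>exp (z \<bullet> w - (norm w)\<^sup>2 / 2) - 1 - z \<bullet> w\<bar> \<le> exp (z \<bullet> w - (norm w)\<^sup>2 / 2) + 1 + norm z * norm w" for z
        using Cauchy_Schwarz_ineq2[of z w] exp_ge_zero[of "z \<bullet> w - (norm w)\<^sup>2 / 2"] by linarith
    qed (auto simp: integral_cameron_martin_density integrable_std_gauss_norm)
    also have "\<dots> = 2 + m * norm w"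
      using std_gauss.prob_space[where 'a='a] integral_cameron_martin_density[of w] integrable_std_gauss_norm[where 'a='a]
      by (simp add: m_def)
    also have "\<dots> \<le> (2 + m) * (norm w)\<^sup>2"
    proof -
      have "norm w \<le> (norm w)\<^sup>2" "1 \<le> (norm w)\<^sup>2"
        using False by (auto simp: power2_eq_square mult_le_cancel_left1 intro: order.trans[of 1 "norm w"])
      then show ?thesis using m mult_left_mono[of "norm w" "(norm w)\<^sup>2" m] by (simp add: algebra_simps)
    qed
    also have "\<dots> \<le> K * (norm w)\<^sup>2" using m by (intro mult_right_mono) (auto simp: K_def)
    finally show ?thesis .
  qed
  then show ?thesis using m by (intro exI[of _ K]) (auto simp: K_def)
qed

text \<open>The slope \<open>a\<close> is the gradient in the form given by Gaussian integration by
  parts, the mean of \<open>h (x + sqrt \<sigma> *\<^sub>R z) *\<^sub>R z\<close> divided by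
  \<open>sqrt \<sigma>\<close>. Slope and remainder are of order \<open>1 / sqrt \<sigma>\<close>
  and \<open>1 / \<sigma>\<close>; their values at \<open>\<sigma> = \<tau>\<close> give the uniform
  \<open>L\<close>, which is why a positive \<open>\<tau>\<close> has to be kept.\<close>

lemma gauss_smooth_taylor:
  fixes h :: "'a::euclidean_space \<Rightarrow> real"
  assumes [measurable]: "h \<in> borel_measurable borel" and bd: "\<And>x. \<bar>h x\<bar> \<le> B" and \<tau>: "0 < \<tau>"
  shows "\<exists>L\<ge>0. \<forall>\<sigma>\<ge>\<tau>. \<forall>x. \<exists>a. norm a \<le> L \<and>
    (\<forall>v. \<bar>gauss_smooth \<sigma> h (x + v) - gauss_smooth \<sigma> h x - a \<bullet> v\<bar> \<le> L * (norm v)\<^sup>2)"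
proof -
  obtain K where K: "0 \<le> K" "\<And>w::'a. (\<integral>z. \<bar>exp (z \<bullet> w - (norm w)\<^sup>2 / 2) - 1 - z \<bullet> w\<bar> \<partial>std_gauss) \<le> K * (norm w)\<^sup>2"
    using cameron_martin_remainder by blast
  define m where "m = (\<integral>z. norm (z::'a) \<partial>std_gauss)"
  define L where "L = max (B * m / sqrt \<tau>) (B * K / \<tau>)"
  have B: "0 \<le> B" using bd[of 0] by linarith
  have m: "0 \<le> m" by (simp add: m_def)
  have L0: "0 \<le> L" using B m \<tau> by (simp add: L_def le_max_iff_disj)
  have "\<exists>a. norm a \<le> L \<and>
    (\<forall>v. \<bar>gauss_smooth \<sigma> h (x + v) - gauss_smooth \<sigma> h x - a \<bullet> v\<bar> \<le> L * (norm v)\<^sup>2)"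
    if \<sigma>: "\<tau> \<le> \<sigma>" for \<sigma> x
  proof -
    have \<sigma>0: "0 < \<sigma>" using \<sigma> \<tau> by simp
    let ?H = "\<lambda>z. h (x + sqrt \<sigma> *\<^sub>R z)"
    have iz: "integrable std_gauss (\<lambda>z. ?H z *\<^sub>R z)"
    proof (rule Bochner_Integration.integrable_bound[OF integrable_mult_right[OF integrable_std_gauss_norm, of B]])
      show "AE z in std_gauss. norm (?H z *\<^sub>R z) \<le> norm (B * norm z)"
        using bd B by (intro AE_I2) (auto simp: abs_mult intro!: mult_right_mono)
    qed measurable
    define a where "a = (\<integral>z. ?H z *\<^sub>R z \<partial>std_gauss) /\<^sub>R sqrt \<sigma>"
    have "norm (\<integral>z. ?H z *\<^sub>R z \<partial>std_gauss) \<le> (\<integral>z. norm (?H z *\<^sub>R z) \<partial>std_gauss)"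
      by (rule integral_norm_bound)
    also have "\<dots> \<le> (\<integral>z. B * norm (z::'a) \<partial>std_gauss)"
      using integrable_norm[OF iz] bd
      by (intro integral_mono) (auto simp: integrable_std_gauss_norm intro!: mult_right_mono)
    finally have "norm (\<integral>z. ?H z *\<^sub>R z \<partial>std_gauss) \<le> B * m" by (simp add: m_def)
    then have "norm a \<le> B * m / sqrt \<sigma>"
      using \<sigma>0 by (simp add: a_def divide_simps)
    also have "\<dots> \<le> B * m / sqrt \<tau>"
      using \<tau> \<sigma> B m by (intro divide_left_mono) auto
    finally have 1: "norm a \<le> L" by (simp add: L_def)
    have "\<bar>gauss_smooth \<sigma> h (x + v) - gauss_smooth \<sigma> h x - a \<bullet> v\<bar> \<le> L * (norm v)\<^sup>2" for v
    proof -
      define w where "w = v /\<^sub>R sqrt \<sigma>"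
      let ?D = "\<lambda>z. exp (z \<bullet> w - (norm w)\<^sup>2 / 2)"
      have v: "v = sqrt \<sigma> *\<^sub>R w" using \<sigma>0 by (simp add: w_def)
      have "gauss_smooth \<sigma> h (x + v) = (\<integral>z. ?H (z + w) \<partial>std_gauss)"
        unfolding gauss_smooth_def v by (simp add: scaleR_add_right add_ac)
      also have "\<dots> = (\<integral>z. ?D z * ?H z \<partial>std_gauss)"
        by (rule cameron_martin) measurable
      finally have g1: "gauss_smooth \<sigma> h (x + v) = (\<integral>z. ?D z * ?H z \<partial>std_gauss)" .
      have i1: "integrable std_gauss (\<lambda>z. ?D z * ?H z)"
        using bd by (subst cameron_martin(2)[symmetric]) (auto intro!: integrable_std_gauss_bounded[of _ B])
      have i2: "integrable std_gauss ?H"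
        using bd by (auto intro!: integrable_std_gauss_bounded[of _ B])
      have i3: "integrable std_gauss (\<lambda>z. ?H z * (z \<bullet> w))"
        using integrable_inner_left[OF iz, of w] by simp
      have li: "integrable std_gauss (\<lambda>z::'a. z \<bullet> w)"
        by (rule Bochner_Integration.integrable_bound[OF integrable_mult_left[OF integrable_std_gauss_norm, of "norm w"]])
          (auto intro!: AE_I2 Cauchy_Schwarz_ineq2)
      have "a \<bullet> v = (\<integral>z. ?H z *\<^sub>R z \<partial>std_gauss) \<bullet> w"
        using \<sigma>0 by (simp add: a_def v)
      also have "\<dots> = (\<integral>z. ?H z * (z \<bullet> w) \<partial>std_gauss)"
        using iz by (subst integral_inner_left[symmetric]) auto
      finally have "gauss_smooth \<sigma> h (x + v) - gauss_smooth \<sigma> h x - a \<bullet> v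
          = (\<integral>z. ?H z * (?D z - 1 - z \<bullet> w) \<partial>std_gauss)"
        unfolding g1 using i1 i2 i3
        by (simp add: gauss_smooth_def algebra_simps)
      also have "\<bar>\<dots>\<bar> \<le> (\<integral>z. \<bar>?H z * (?D z - 1 - z \<bullet> w)\<bar> \<partial>std_gauss)"
        by (rule integral_abs_bound)
      also have "\<dots> \<le> (\<integral>z. B * \<bar>?D z - 1 - z \<bullet> w\<bar> \<partial>std_gauss)"
      proof (rule integral_mono)
        have "integrable std_gauss (\<lambda>z. ?D z * ?H z - ?H z - ?H z * (z \<bullet> w))"
          using i1 i2 i3 by auto
        then show "integrable std_gauss (\<lambda>z. \<bar>?H z * (?D z - 1 - z \<bullet> w)\<bar>)"
          by (simp add: algebra_simps)
        show "integrable std_gauss (\<lambda>z. B * \<bar>?D z - 1 - z \<bullet> w\<bar>)"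
          using integral_cameron_martin_density[of w] li by auto
        show "\<bar>?H z * (?D z - 1 - z \<bullet> w)\<bar> \<le> B * \<bar>?D z - 1 - z \<bullet> w\<bar>" for z
          using bd by (auto simp: abs_mult intro!: mult_right_mono)
      qed
      also have "\<dots> \<le> B * (K * (norm w)\<^sup>2)"
        using K(2)[of w] B by (auto intro!: mult_left_mono)
      also have "\<dots> = B * K / \<sigma> * (norm v)\<^sup>2"
        using \<sigma>0 by (simp add: w_def power_mult_distrib power_inverse divide_inverse)
      also have "\<dots> \<le> L * (norm v)\<^sup>2"
      proof (rule mult_right_mono)
        have "B * K / \<sigma> \<le> B * K / \<tau>" using \<sigma> \<tau> B K by (intro divide_left_mono) auto
        then show "B * K / \<sigma> \<le> L" by (simp add: L_def)
      qed simp
      finally show ?thesis .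
    qed
    with 1 show ?thesis by blast
  qed
  with L0 show ?thesis by blast
qed

subsection \<open>Correlated Gaussian pairs\<close>

text \<open>For \<open>0 < r \<le> 1\<close>, averaging a function of \<open>correlate r z\<close>
  over the second component is Mehler's formula for the Ornstein-Uhlenbeck semigroup at the time
  \<open>t\<close> with \<open>r = exp (- t)\<close>.\<close>

definition correlate :: "real \<Rightarrow> 'a::euclidean_space \<times> 'a \<Rightarrow> 'a" where
  "correlate r z = r *\<^sub>R fst z + sqrt (1 - r\<^sup>2) *\<^sub>R snd z"

text \<open>A function of one vector \<open>z\<close> of the product space: since \<open>fst\<close>
  and \<open>correlate r\<close> are linear, scaling \<open>z\<close> or adding an independent
  increment moves both Gaussian variables together and keeps their correlation.\<close>

definition ent_integrand ::
    "real \<Rightarrow> ('a::euclidean_space \<Rightarrow> real) \<Rightarrow> ('a \<Rightarrow> real) \<Rightarrow> 'a \<times> 'a \<Rightarrow> real" where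
  "ent_integrand r g f z = g (fst z) * ln (f (correlate r z)) - r\<^sup>2 * (g (fst z) * ln (g (fst z)))"

lemma borel_measurable_correlate [measurable]: "correlate r \<in> borel \<rightarrow>\<^sub>M borel"
  unfolding correlate_def by (rule borel_measurable_rotate)

lemma borel_measurable_fst_Pair [measurable]:
  "(fst :: 'a::euclidean_space \<times> 'a \<Rightarrow> 'a) \<in> borel \<rightarrow>\<^sub>M borel"
  by (intro borel_measurable_continuous_onI continuous_intros)

lemma correlate_add: "correlate r (z + w) = correlate r z + correlate r w"
  and correlate_scaleR: "correlate r (c *\<^sub>R z) = c *\<^sub>R correlate r z"
  and correlate_zero [simp]: "correlate r 0 = 0"
  by (simp_all add: correlate_def algebra_simps)

lemma borel_measurable_ent_integrand [measurable]:
  assumes [measurable]: "g \<in> borel_measurable borel" "f \<in> borel_measurable borel"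
  shows "ent_integrand r g f \<in> borel_measurable borel"
proof -
  have [measurable]: "(\<lambda>z::'a \<times> 'a. g (fst z)) \<in> borel_measurable borel" "(\<lambda>z. f (correlate r z)) \<in> borel_measurable borel"
    by (auto intro!: measurable_compose[OF borel_measurable_fst_Pair] measurable_compose[OF borel_measurable_correlate])
  show ?thesis unfolding ent_integrand_def by measurable
qed

lemma distr_std_gauss_correlate:
  "0 \<le> r \<Longrightarrow> r \<le> 1 \<Longrightarrow> distr std_gauss borel (correlate r) = (std_gauss :: 'a::euclidean_space measure)"
  unfolding correlate_def by (intro distr_std_gauss_rotate) (simp add: power_le_one)

lemma integral_std_gauss_orthogonal:
  fixes h :: "'a::euclidean_space \<Rightarrow> real" and T :: "'a \<Rightarrow> 'a"
  assumes T: "orthogonal_transformation T" and [measurable]: "h \<in> borel_measurable borel"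
  shows "(\<integral>x. h (T x) \<partial>std_gauss) = (\<integral>x. h x \<partial>std_gauss)"
proof -
  note [measurable] = borel_measurable_orthogonal_transformation[OF T]
  have "(\<integral>x. h x \<partial>std_gauss) = (\<integral>x. h x \<partial>distr std_gauss borel T)"
    by (simp add: distr_std_gauss_orthogonal[OF T])
  then show ?thesis by (subst (asm) integral_distr) auto
qed

lemma integral_std_gauss_odd:
  fixes h :: "'a::euclidean_space \<Rightarrow> real" and T :: "'a \<Rightarrow> 'a"
  assumes T: "orthogonal_transformation T" and h: "h \<in> borel_measurable borel" and odd: "\<And>x. h (T x) = - h x"
  shows "(\<integral>x. h x \<partial>std_gauss) = 0"
  using integral_std_gauss_orthogonal[OF T h] by (simp add: odd)

lemma integrable_std_gauss_inner_mult_inner: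
  "integrable std_gauss (\<lambda>x::'a::euclidean_space. (u \<bullet> x) * (v \<bullet> x))"
proof (rule Bochner_Integration.integrable_bound[OF integrable_mult_right[OF integrable_std_gauss_exp_norm[of 1], of "2 * (norm u * norm v)"]])
  show "AE x in std_gauss. norm ((u \<bullet> x) * (v \<bullet> x)) \<le> norm (2 * (norm u * norm v) * exp (1 * norm (x::'a)))"
  proof (intro AE_I2)
    fix x :: 'a
    have "\<bar>u \<bullet> x\<bar> * \<bar>v \<bullet> x\<bar> \<le> (norm u * norm x) * (norm v * norm x)"
      by (intro mult_mono Cauchy_Schwarz_ineq2) auto
    also have "\<dots> = (norm u * norm v) * (norm x)\<^sup>2" by (simp add: power2_eq_square)
    also have "\<dots> \<le> (norm u * norm v) * (2 * exp (norm x))"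
      using exp_lower_Taylor_quadratic[of "norm x"] norm_ge_zero[of x] by (intro mult_left_mono) (linarith, simp)
    finally show "norm ((u \<bullet> x) * (v \<bullet> x)) \<le> norm (2 * (norm u * norm v) * exp (1 * norm x))"
      by (simp add: abs_mult)
  qed
qed measurable

text \<open>Reflecting and swapping the two independent components shows that \<^term>\<open>correlate r\<close> has
  correlation \<^term>\<open>r\<close> with the first one, so that the difference of the two sides is the second
  moment of a linear form.\<close>
lemma std_gauss_correlate_covariance:
  fixes a b :: "'a::euclidean_space"
  assumes r: "0 \<le> r" "r \<le> 1"
  shows "2 * k * (\<integral>z. (a \<bullet> fst z) * (b \<bullet> correlate r z) \<partial>std_gauss)
    \<le> (\<integral>z. (b \<bullet> correlate r z)\<^sup>2 \<partial>std_gauss) + r\<^sup>2 * k\<^sup>2 * (\<integral>z. (a \<bullet> fst z)\<^sup>2 \<partial>(std_gauss :: ('a \<times> 'a) measure))"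
proof -
  let ?M = "std_gauss :: ('a \<times> 'a) measure"
  let ?q = "sqrt (1 - r\<^sup>2)"
  have rq: "?q\<^sup>2 = 1 - r\<^sup>2" using r by (simp add: power_le_one)
  have [measurable]: "(\<lambda>z::'a \<times> 'a. u \<bullet> fst z) \<in> borel_measurable borel"
     "(\<lambda>z::'a \<times> 'a. u \<bullet> snd z) \<in> borel_measurable borel" for u
    by (intro borel_measurable_continuous_onI continuous_intros)+
  have lin: "u \<bullet> fst z = (u, 0) \<bullet> z" "u \<bullet> snd z = (0, u) \<bullet> z" for u :: 'a and z
    by (simp_all add: inner_prod_def)
  have i1: "integrable ?M (\<lambda>z. (u \<bullet> fst z) * (v \<bullet> fst z))" for u v
    unfolding lin by (rule integrable_std_gauss_inner_mult_inner)
  have i2: "integrable ?M (\<lambda>z. (u \<bullet> fst z) * (v \<bullet> snd z))" for u v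
    unfolding lin by (rule integrable_std_gauss_inner_mult_inner)
  have i3: "integrable ?M (\<lambda>z. (u \<bullet> snd z) * (v \<bullet> snd z))" for u v
    unfolding lin by (rule integrable_std_gauss_inner_mult_inner)
  have z: "(\<integral>z. (u \<bullet> fst z) * (v \<bullet> snd z) \<partial>?M) = 0" for u v
  proof (rule integral_std_gauss_odd)
    show "orthogonal_transformation (\<lambda>z::'a \<times> 'a. (fst z, - snd z))"
      by (auto simp: orthogonal_transformation norm_prod_def intro!: linearI)
  qed auto
  have sw: "(\<integral>z. (u \<bullet> snd z) * (v \<bullet> snd z) \<partial>?M) = (\<integral>z. (u \<bullet> fst z) * (v \<bullet> fst z) \<partial>?M)" for u v
  proof -
    have "orthogonal_transformation (\<lambda>z::'a \<times> 'a. (snd z, fst z))"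
      by (auto simp: orthogonal_transformation norm_prod_def add.commute intro!: linearI)
    from integral_std_gauss_orthogonal[OF this, of "\<lambda>z. (u \<bullet> fst z) * (v \<bullet> fst z)"] show ?thesis by simp
  qed
  let ?I = "\<lambda>u v. \<integral>z. (u \<bullet> fst z) * (v \<bullet> fst z) \<partial>?M"
  have pq: "(\<integral>z. (a \<bullet> fst z) * (b \<bullet> correlate r z) \<partial>?M) = r * ?I a b"
  proof -
    have "(\<integral>z. (a \<bullet> fst z) * (b \<bullet> correlate r z) \<partial>?M)
        = (\<integral>z. r * ((a \<bullet> fst z) * (b \<bullet> fst z)) + ?q * ((a \<bullet> fst z) * (b \<bullet> snd z)) \<partial>?M)"
      by (simp add: correlate_def inner_add_right algebra_simps)
    then show ?thesis using i1[of a b] i2[of a b] by (simp add: z)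
  qed
  have qq: "(\<integral>z. (b \<bullet> correlate r z)\<^sup>2 \<partial>?M) = ?I b b"
  proof -
    have "(\<integral>z. (b \<bullet> correlate r z)\<^sup>2 \<partial>?M)
        = (\<integral>z. r\<^sup>2 * ((b \<bullet> fst z) * (b \<bullet> fst z)) + (2 * r * ?q) * ((b \<bullet> fst z) * (b \<bullet> snd z))
             + ?q\<^sup>2 * ((b \<bullet> snd z) * (b \<bullet> snd z)) \<partial>?M)"
      by (intro arg_cong[where f="integral\<^sup>L ?M"] ext)
        (simp add: correlate_def inner_add_right power2_eq_square algebra_simps)
    also have "\<dots> = r\<^sup>2 * ?I b b + ?q\<^sup>2 * ?I b b"
      using i1[of b b] i2[of b b] i3[of b b] by (simp only: integral_add integrable_mult_right integral_mult_right_zero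
          Bochner_Integration.integrable_add Bochner_Integration.integral_add z sw mult_zero_right add_0_right)
    finally show ?thesis by (simp add: rq algebra_simps)
  qed
  \<comment> \<open>The cross term carries the correlation \<open>r\<close>, so exactly the
    coefficient \<open>r\<^sup>2 * k\<^sup>2\<close> completes the square. This is where the weight
    \<open>r\<^sup>2\<close> of the entropy term is determined.\<close>
  have "0 \<le> (\<integral>z. (b \<bullet> fst z - (r * k) * (a \<bullet> fst z))\<^sup>2 \<partial>?M)" by simp
  also have "\<dots> = (\<integral>z. (b \<bullet> fst z) * (b \<bullet> fst z) - (2 * r * k) * ((a \<bullet> fst z) * (b \<bullet> fst z))
        + (r\<^sup>2 * k\<^sup>2) * ((a \<bullet> fst z) * (a \<bullet> fst z)) \<partial>?M)"
    by (intro arg_cong[where f="integral\<^sup>L ?M"] ext) (simp add: power2_eq_square algebra_simps)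
  also have "\<dots> = ?I b b - (2 * r * k) * ?I a b + (r\<^sup>2 * k\<^sup>2) * ?I a a"
    using i1[of b b] i1[of a b] i1[of a a] by simp
  finally show ?thesis unfolding pq qq by (simp add: power2_eq_square algebra_simps)
qed

section \<open>One time step and its iteration\<close>

lemma ln_bounded_interval:
  assumes "0 < c" "c \<le> y" "y \<le> C"
  shows "\<bar>ln y\<bar> \<le> \<bar>ln c\<bar> + \<bar>ln (C::real)\<bar>"
proof -
  have "ln c \<le> ln y" "ln y \<le> ln C" using assms by (auto intro!: ln_mono)
  then show ?thesis by linarith
qed

lemma ent_integrand_bounded:
  assumes c: "0 < c" and g: "\<And>x. c \<le> g x" "\<And>x. g x \<le> C" and f: "\<And>x. c \<le> f x" "\<And>x. f x \<le> C"
  shows "\<bar>ent_integrand r g f z\<bar> \<le> (1 + r\<^sup>2) * (C * (\<bar>ln c\<bar> + \<bar>ln C\<bar>))"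
proof -
  have *: "\<bar>g (fst z) * ln y\<bar> \<le> C * (\<bar>ln c\<bar> + \<bar>ln C\<bar>)" if "c \<le> y" "y \<le> C" for y
    unfolding abs_mult using that g[of "fst z"] c by (intro mult_mono ln_bounded_interval) auto
  have "\<bar>ent_integrand r g f z\<bar> \<le> \<bar>g (fst z) * ln (f (correlate r z))\<bar> + r\<^sup>2 * \<bar>g (fst z) * ln (g (fst z))\<bar>"
    unfolding ent_integrand_def by (rule order.trans[OF abs_triangle_ineq4]) (simp add: abs_mult)
  also have "\<dots> \<le> C * (\<bar>ln c\<bar> + \<bar>ln C\<bar>) + r\<^sup>2 * (C * (\<bar>ln c\<bar> + \<bar>ln C\<bar>))"
    by (intro add_mono mult_left_mono * f g) auto
  finally show ?thesis by (simp add: algebra_simps)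
qed

text \<open>The point is that \<open>K\<close> does not depend on \<open>\<sigma>\<close>,
  \<open>h\<close> or \<open>z\<close>; otherwise the errors of successive steps could not be
  summed. With \<open>u = sqrt h\<close>, both smoothed functions are affine in \<open>w\<close> up
  to \<open>u\<^sup>2\<close> times the majorant \<open>T\<close>, so
  \<open>entropy_local_step\<close> applies under the Gaussian law of \<open>w\<close>.\<close>

lemma ent_integrand_smooth_step:
  fixes g f :: "'a::euclidean_space \<Rightarrow> real"
  assumes [measurable]: "g \<in> borel_measurable borel" "f \<in> borel_measurable borel"
    and c: "0 < c" and g: "\<And>x. c \<le> g x" "\<And>x. g x \<le> C" and f: "\<And>x. c \<le> f x" "\<And>x. f x \<le> C"
    and r: "0 \<le> r" "r \<le> 1" and \<tau>: "0 < \<tau>"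
  shows "\<exists>K. \<forall>\<sigma> h z. \<tau> \<le> \<sigma> \<longrightarrow> 0 \<le> h \<longrightarrow> h \<le> 1 \<longrightarrow>
    (\<integral>w. ent_integrand r (gauss_smooth \<sigma> g) (gauss_smooth \<sigma> f) (z + sqrt h *\<^sub>R w) \<partial>std_gauss)
     \<le> ent_integrand r (gauss_smooth (\<sigma> + h) g) (gauss_smooth (\<sigma> + h) f) z + sqrt h ^ 3 * K"
proof -
  let ?M = "std_gauss :: ('a \<times> 'a) measure"
  have bd: "\<bar>g x\<bar> \<le> C" "\<bar>f x\<bar> \<le> C" for x using c g[of x] f[of x] by auto
  obtain Lg where Lg: "Lg \<ge> 0" "\<And>\<sigma> x. \<tau> \<le> \<sigma> \<Longrightarrow> \<exists>a. norm a \<le> Lg \<and>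
    (\<forall>v. \<bar>gauss_smooth \<sigma> g (x + v) - gauss_smooth \<sigma> g x - a \<bullet> v\<bar> \<le> Lg * (norm v)\<^sup>2)"
    using gauss_smooth_taylor[of g C, OF _ bd(1) \<tau>] by auto
  obtain Lf where Lf: "Lf \<ge> 0" "\<And>\<sigma> x. \<tau> \<le> \<sigma> \<Longrightarrow> \<exists>a. norm a \<le> Lf \<and>
    (\<forall>v. \<bar>gauss_smooth \<sigma> f (x + v) - gauss_smooth \<sigma> f x - a \<bullet> v\<bar> \<le> Lf * (norm v)\<^sup>2)"
    using gauss_smooth_taylor[of f C, OF _ bd(2) \<tau>] by auto
  define L where "L = 1 + Lg + Lf"
  \<comment> \<open>One majorant for slopes and remainders alike: displacements have norm at most
    \<open>2 * norm w\<close>, and \<open>(2 * norm w)\<^sup>2 \<le> 8 * exp (norm w)\<close>. The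
    summand 1 in \<open>L\<close> ensures \<open>T \<ge> 1\<close>.\<close>
  define T where "T w = 8 * L * exp (norm w)" for w :: "'a \<times> 'a"
  have L: "1 \<le> L" "Lg \<le> L" "Lf \<le> L" using Lg(1) Lf(1) by (auto simp: L_def)
  have [measurable]: "T \<in> borel_measurable borel" unfolding T_def by measurable
  define K where "K = C * (\<integral>w. 4 * (2 * T w + (\<integral>w. T w \<partial>?M))\<^sup>2 / c\<^sup>2
          + (2 * T w + (\<integral>w. T w \<partial>?M)) ^ 3 / c ^ 3 * (1 + C / c) \<partial>?M)"
  have T1: "1 \<le> T w" for w
  proof -
    have "1 * 1 \<le> (8 * L) * exp (norm w)" using L by (intro mult_mono) auto
    then show ?thesis by (simp add: T_def)
  qed
  have T3: "integrable ?M (\<lambda>w. T w ^ 3)"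
  proof -
    have "T w ^ 3 = (8 * L) ^ 3 * exp (3 * norm w)" for w
      unfolding T_def power_mult_distrib by (simp add: exp_of_nat_mult[symmetric])
    then show ?thesis by (simp add: integrable_std_gauss_exp_norm)
  qed
  have q: "0 \<le> sqrt (1 - r\<^sup>2)" "sqrt (1 - r\<^sup>2) \<le> 1" using r by (auto simp: power_le_one)
  have ncor: "norm (correlate r w) \<le> 2 * norm w" for w :: "'a \<times> 'a"
  proof -
    have "norm (correlate r w) \<le> norm (r *\<^sub>R fst w) + norm (sqrt (1 - r\<^sup>2) *\<^sub>R snd w)"
      unfolding correlate_def by (rule norm_triangle_ineq)
    also have "\<dots> \<le> 1 * norm (fst w) + 1 * norm (snd w)"
      using r q by (intro add_mono) (auto simp: mult_left_le_one_le)
    also have "\<dots> \<le> 2 * norm w" using norm_fst_le[of "fst w" "snd w"] norm_snd_le[of "snd w" "fst w"] by simp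
    finally show ?thesis .
  qed
  have nfst: "norm (fst w) \<le> 2 * norm w" for w :: "'a \<times> 'a"
    using norm_fst_le[of "fst w" "snd w"] norm_ge_zero[of w] unfolding prod.collapse by linarith
  have nT: "l * norm v \<le> T w" "l * (norm v)\<^sup>2 \<le> T w"
    if "norm v \<le> 2 * norm w" "0 \<le> l" "l \<le> L" for l and v :: 'a and w
  proof -
    have e: "norm w \<le> exp (norm w)" using exp_ge_add_one_self[of "norm w"] by linarith
    have e2: "(norm w)\<^sup>2 \<le> 2 * exp (norm w)"
      using exp_lower_Taylor_quadratic[of "norm w"] norm_ge_zero[of w] by linarith
    have "l * norm v \<le> L * (8 * exp (norm w))"
    proof (rule mult_mono)
      show "norm v \<le> 8 * exp (norm w)" using that(1) e exp_ge_zero[of "norm w"] by linarith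
    qed (use that L in auto)
    then show "l * norm v \<le> T w" by (simp add: T_def)
    have "(norm v)\<^sup>2 \<le> (2 * norm w)\<^sup>2" using that by (intro power_mono) auto
    also have "\<dots> \<le> 8 * exp (norm w)" using e2 by (simp add: power_mult_distrib)
    finally have "l * (norm v)\<^sup>2 \<le> L * (8 * exp (norm w))"
      using that L by (intro mult_mono) auto
    then show "l * (norm v)\<^sup>2 \<le> T w" by (simp add: T_def)
  qed
  have "(\<integral>w. ent_integrand r (gauss_smooth \<sigma> g) (gauss_smooth \<sigma> f) (z + sqrt h *\<^sub>R w) \<partial>?M)
     \<le> ent_integrand r (gauss_smooth (\<sigma> + h) g) (gauss_smooth (\<sigma> + h) f) z + sqrt h ^ 3 * K"
    if \<sigma>: "\<tau> \<le> \<sigma>" and h: "0 \<le> h" "h \<le> 1" for \<sigma> h z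
  proof -
    obtain a where a: "norm a \<le> Lg"
      "\<And>v. \<bar>gauss_smooth \<sigma> g (fst z + v) - gauss_smooth \<sigma> g (fst z) - a \<bullet> v\<bar> \<le> Lg * (norm v)\<^sup>2"
      using Lg(2)[OF \<sigma>, of "fst z"] by blast
    obtain b where b: "norm b \<le> Lf"
      "\<And>v. \<bar>gauss_smooth \<sigma> f (correlate r z + v) - gauss_smooth \<sigma> f (correlate r z) - b \<bullet> v\<bar> \<le> Lf * (norm v)\<^sup>2"
      using Lf(2)[OF \<sigma>, of "correlate r z"] by blast
    define u where "u = sqrt h"
    have u: "0 \<le> u" "u \<le> 1" "u\<^sup>2 = h" using h by (auto simp: u_def)
    let ?g = "\<lambda>w::'a \<times> 'a. gauss_smooth \<sigma> g (fst z + u *\<^sub>R fst w)"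
    let ?f = "\<lambda>w. gauss_smooth \<sigma> f (correlate r z + u *\<^sub>R correlate r w)"
    have m1: "(\<lambda>x. gauss_smooth \<sigma> g (fst z + u *\<^sub>R x)) \<in> borel_measurable borel"
      "(\<lambda>x. gauss_smooth \<sigma> f (correlate r z + u *\<^sub>R x)) \<in> borel_measurable borel"
      by measurable
    have mg: "?g \<in> borel_measurable borel"
      by (rule measurable_compose[OF borel_measurable_fst_Pair m1(1)])
    have mf: "?f \<in> borel_measurable borel"
      by (rule measurable_compose[OF borel_measurable_correlate m1(2)])
    have mp: "(\<lambda>w::'a \<times> 'a. a \<bullet> fst w) \<in> borel_measurable borel"
      by (rule measurable_compose[OF borel_measurable_fst_Pair]) measurable
    have mq: "(\<lambda>w. b \<bullet> correlate r w) \<in> borel_measurable borel"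
      by (rule measurable_compose[OF borel_measurable_correlate]) measurable
    have st: "0 \<le> \<sigma>" using \<sigma> \<tau> by simp
    \<comment> \<open>Both \<open>fst w\<close> and \<open>correlate r w\<close> are standard
      Gaussian, so averaging over \<open>w\<close> is a further smoothing by time \<open>h\<close>,
      and the semigroup law identifies the mean.\<close>
    have Eg: "(\<integral>w. ?g w \<partial>?M) = gauss_smooth (\<sigma> + h) g (fst z)"
    proof -
      have "(\<integral>w. ?g w \<partial>?M) = (\<integral>x. gauss_smooth \<sigma> g (fst z + u *\<^sub>R x) \<partial>distr ?M borel fst)"
        using m1 by (subst integral_distr) auto
      also have "\<dots> = gauss_smooth h (gauss_smooth \<sigma> g) (fst z)"
        unfolding distr_std_gauss_fst by (simp add: gauss_smooth_def[of h] u_def)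
      finally show ?thesis using gauss_smooth_add[of g C \<sigma> h] bd st h by simp
    qed
    have Ef: "(\<integral>w. ?f w \<partial>?M) = gauss_smooth (\<sigma> + h) f (correlate r z)"
    proof -
      have "(\<integral>w. ?f w \<partial>?M) = (\<integral>x. gauss_smooth \<sigma> f (correlate r z + u *\<^sub>R x) \<partial>distr ?M borel (correlate r))"
        using m1 by (subst integral_distr) auto
      also have "\<dots> = gauss_smooth h (gauss_smooth \<sigma> f) (correlate r z)"
        unfolding distr_std_gauss_correlate[OF r] by (simp add: gauss_smooth_def[of h] u_def)
      finally show ?thesis using gauss_smooth_add[of f C \<sigma> h] bd st h by simp
    qed
    have um: "orthogonal_transformation (uminus :: 'a \<times> 'a \<Rightarrow> 'a \<times> 'a)"
      by (auto simp: orthogonal_transformation intro!: linearI)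
    have "(\<integral>w. ?g w * ln (?f w) - r\<^sup>2 * (?g w * ln (?g w)) \<partial>?M)
       \<le> (\<integral>w. ?g w \<partial>?M) * ln (\<integral>w. ?f w \<partial>?M) - r\<^sup>2 * ((\<integral>w. ?g w \<partial>?M) * ln (\<integral>w. ?g w \<partial>?M)) + u ^ 3 * K"
      unfolding K_def
    proof (rule std_gauss.entropy_local_step[where p="\<lambda>w. a \<bullet> fst w" and q="\<lambda>w. b \<bullet> correlate r w"
          and ?g0.0="gauss_smooth \<sigma> g (fst z)" and ?f0.0="gauss_smooth \<sigma> f (correlate r z)"])
      show "\<bar>a \<bullet> fst w\<bar> \<le> T w" for w
        using Cauchy_Schwarz_ineq2[of a "fst w"] nT(1)[OF nfst, of "norm a" w] a(1) L by simp
      show "\<bar>b \<bullet> correlate r w\<bar> \<le> T w" for w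
        using Cauchy_Schwarz_ineq2[of b "correlate r w"] nT(1)[OF ncor, of "norm b" w] b(1) L by simp
      show "\<bar>?g w - gauss_smooth \<sigma> g (fst z) - u * (a \<bullet> fst w)\<bar> \<le> u\<^sup>2 * T w" for w
      proof -
        have "\<bar>?g w - gauss_smooth \<sigma> g (fst z) - u * (a \<bullet> fst w)\<bar> \<le> u\<^sup>2 * (Lg * (norm (fst w))\<^sup>2)"
          using a(2)[of "u *\<^sub>R fst w"] by (simp add: power_mult_distrib mult.left_commute)
        also have "\<dots> \<le> u\<^sup>2 * T w" using nT(2)[OF nfst, of Lg w] Lg L by (intro mult_left_mono) auto
        finally show ?thesis .
      qed
      show "\<bar>?f w - gauss_smooth \<sigma> f (correlate r z) - u * (b \<bullet> correlate r w)\<bar> \<le> u\<^sup>2 * T w" for w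
      proof -
        have "\<bar>?f w - gauss_smooth \<sigma> f (correlate r z) - u * (b \<bullet> correlate r w)\<bar> \<le> u\<^sup>2 * (Lf * (norm (correlate r w))\<^sup>2)"
          using b(2)[of "u *\<^sub>R correlate r w"] by (simp add: power_mult_distrib mult.left_commute)
        also have "\<dots> \<le> u\<^sup>2 * T w" using nT(2)[OF ncor, of Lf w] Lf L by (intro mult_left_mono) auto
        finally show ?thesis .
      qed
      show "(\<integral>w. a \<bullet> fst w \<partial>?M) = 0"
        by (rule integral_std_gauss_odd[OF um mp]) simp
      show "(\<integral>w. b \<bullet> correlate r w \<partial>?M) = 0"
        by (rule integral_std_gauss_odd[OF um mq]) (simp add: correlate_def inner_add_right inner_diff_right)
      show "2 * k * (\<integral>w. (a \<bullet> fst w) * (b \<bullet> correlate r w) \<partial>?M)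
        \<le> (\<integral>w. (b \<bullet> correlate r w)\<^sup>2 \<partial>?M) + r\<^sup>2 * k\<^sup>2 * (\<integral>w. (a \<bullet> fst w)\<^sup>2 \<partial>?M)" for k
        by (rule std_gauss_correlate_covariance[OF r])
    qed (use mg mf mp mq c r u T1 T3 gauss_smooth_bounds[OF assms(1) g] gauss_smooth_bounds[OF assms(2) f]
        in \<open>auto simp: power_le_one\<close>)
    then show ?thesis
      unfolding Eg Ef by (simp add: ent_integrand_def correlate_add correlate_scaleR u_def)
  qed
  then show ?thesis by blast
qed

text \<open>Stands in for a nonpositive time derivative. What matters is that the exponent 3/2
  exceeds 1: the errors of \<open>Suc n\<close> steps of length \<open>h n\<close> add up to
  \<open>T * sqrt (h n) * K\<close>, which tends to 0.\<close>

lemma le_if_small_steps: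
  fixes M :: "real \<Rightarrow> real"
  assumes step: "\<And>t h. 0 \<le> t \<Longrightarrow> 0 \<le> h \<Longrightarrow> h \<le> 1 \<Longrightarrow> t + h \<le> T \<Longrightarrow> M (t + h) \<le> M t + sqrt h ^ 3 * K"
    and T: "0 \<le> T" "T \<le> 1"
  shows "M T \<le> M 0"
proof (rule LIMSEQ_le_const)
  define h where "h n = T / real (Suc n)" for n
  have h: "0 \<le> h n" "h n \<le> T" "real (Suc n) * h n = T" for n
    using T mult_left_mono[of 1 "1 + real n" T] by (auto simp: h_def divide_simps)
  have it: "M (real k * h n) \<le> M 0 + real k * (sqrt (h n) ^ 3 * K)" if "k \<le> Suc n" for k n
    using that
  proof (induction k)
    case (Suc k)
    have "M (real k * h n + h n) \<le> M (real k * h n) + sqrt (h n) ^ 3 * K"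
    proof (rule step)
      have "real (Suc k) * h n \<le> real (Suc n) * h n"
        using Suc.prems h[of n] by (intro mult_right_mono) auto
      then show "real k * h n + h n \<le> T" using h(3)[of n] by (simp add: algebra_simps)
    qed (use h[of n] T in auto)
    then show ?case using Suc by (simp add: algebra_simps)
  qed simp
  have "M T \<le> M 0 + T * sqrt (h n) * K" for n
  proof -
    have "real (Suc n) * (sqrt (h n) ^ 3 * K) = (real (Suc n) * (sqrt (h n))\<^sup>2) * sqrt (h n) * K"
      by (simp add: power3_eq_cube power2_eq_square)
    also have "real (Suc n) * (sqrt (h n))\<^sup>2 = T" using h[of n] by simp
    finally have "real (Suc n) * (sqrt (h n) ^ 3 * K) = T * sqrt (h n) * K" .
    then show ?thesis using it[OF order.refl, of n] unfolding h(3) by argo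
  qed
  then show "\<exists>N. \<forall>n\<ge>N. M T \<le> M 0 + T * sqrt (h n) * K" by blast
  have "h \<longlonglongrightarrow> 0"
    unfolding h_def by (rule LIMSEQ_Suc[OF lim_const_over_n])
  then have "(\<lambda>n. M 0 + T * sqrt (h n) * K) \<longlonglongrightarrow> M 0 + T * sqrt 0 * K"
    by (intro tendsto_intros)
  then show "(\<lambda>n. M 0 + T * sqrt (h n) * K) \<longlonglongrightarrow> M 0" by simp
qed

text \<open>Time runs from 0 to \<open>1 - \<tau>\<close> only, so that the smoothing parameter
  \<open>1 - t\<close> never falls below \<open>\<tau>\<close> and one constant \<open>K\<close>
  serves all steps.\<close>

lemma ent_integrand_smooth_le:
  fixes g f :: "'a::euclidean_space \<Rightarrow> real"
  assumes [measurable]: "g \<in> borel_measurable borel" "f \<in> borel_measurable borel"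
    and c: "0 < c" and g: "\<And>x. c \<le> g x" "\<And>x. g x \<le> C" and f: "\<And>x. c \<le> f x" "\<And>x. f x \<le> C"
    and r: "0 \<le> r" "r \<le> 1" and \<tau>: "0 < \<tau>" "\<tau> \<le> 1"
  shows "(\<integral>z. ent_integrand r (gauss_smooth \<tau> g) (gauss_smooth \<tau> f) (sqrt (1 - \<tau>) *\<^sub>R z) \<partial>std_gauss)
    \<le> ent_integrand r (gauss_smooth 1 g) (gauss_smooth 1 f) 0"
proof -
  obtain K where K: "\<And>\<sigma> h z. \<tau> \<le> \<sigma> \<Longrightarrow> 0 \<le> h \<Longrightarrow> h \<le> 1 \<Longrightarrow>
    (\<integral>w. ent_integrand r (gauss_smooth \<sigma> g) (gauss_smooth \<sigma> f) (z + sqrt h *\<^sub>R w) \<partial>std_gauss)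
     \<le> ent_integrand r (gauss_smooth (\<sigma> + h) g) (gauss_smooth (\<sigma> + h) f) z + sqrt h ^ 3 * K"
    using ent_integrand_smooth_step[OF assms(1-10)] by blast
  let ?J = "\<lambda>\<sigma>. ent_integrand r (gauss_smooth \<sigma> g) (gauss_smooth \<sigma> f)"
  have mJ [measurable]: "?J \<sigma> \<in> borel_measurable borel" for \<sigma> by measurable
  obtain B where B: "\<And>\<sigma> z. \<bar>?J \<sigma> z\<bar> \<le> B"
  proof -
    have "\<bar>?J \<sigma> z\<bar> \<le> (1 + r\<^sup>2) * (C * (\<bar>ln c\<bar> + \<bar>ln C\<bar>))" for \<sigma> z
      by (rule ent_integrand_bounded[OF c]; rule gauss_smooth_bounds[OF _ g] gauss_smooth_bounds[OF _ f]; measurable)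
    then show ?thesis using that by blast
  qed
  define M where "M t = (\<integral>z. ?J (1 - t) (sqrt t *\<^sub>R z) \<partial>std_gauss)" for t
  have "M (1 - \<tau>) \<le> M 0"
  proof (rule le_if_small_steps)
    fix t h assume th: "0 \<le> t" "0 \<le> h" "h \<le> 1" "t + h \<le> 1 - \<tau>"
    \<comment> \<open>The Gaussian vector at time \<open>t + h\<close> is split into the state at
      time \<open>t\<close> and an independent increment; for a fixed state the inner integral is
      the one-step situation with \<open>\<sigma> = 1 - (t + h)\<close>.\<close>
    have "M (t + h) = (\<integral>z. (\<integral>w. ?J (1 - (t + h)) (sqrt t *\<^sub>R z + sqrt h *\<^sub>R w) \<partial>std_gauss) \<partial>std_gauss)"
      unfolding M_def using B th by (intro integral_std_gauss_add) auto
    also have "\<dots> \<le> (\<integral>z. ?J (1 - t) (sqrt t *\<^sub>R z) + sqrt h ^ 3 * K \<partial>std_gauss)"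
    proof (rule integral_mono)
      have "\<bar>\<integral>w. ?J (1 - (t + h)) (sqrt t *\<^sub>R z + sqrt h *\<^sub>R w) \<partial>std_gauss\<bar> \<le> B" for z
      proof -
        have "\<bar>\<integral>w. ?J (1 - (t + h)) (sqrt t *\<^sub>R z + sqrt h *\<^sub>R w) \<partial>std_gauss\<bar>
            \<le> (\<integral>w. \<bar>?J (1 - (t + h)) (sqrt t *\<^sub>R z + sqrt h *\<^sub>R w)\<bar> \<partial>std_gauss)"
          by (rule integral_abs_bound)
        also have "\<dots> \<le> (\<integral>w. B \<partial>(std_gauss :: ('a \<times> 'a) measure))"
          using B order.trans[OF abs_ge_zero B] by (intro integral_mono integrable_std_gauss_bounded[of _ B]) auto
        finally show ?thesis by simp
      qed
      then show "integrable std_gauss (\<lambda>z. \<integral>w. ?J (1 - (t + h)) (sqrt t *\<^sub>R z + sqrt h *\<^sub>R w) \<partial>std_gauss)"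
        by (intro integrable_std_gauss_bounded) auto
      show "integrable std_gauss (\<lambda>z. ?J (1 - t) (sqrt t *\<^sub>R z) + sqrt h ^ 3 * K)"
        using B by (intro Bochner_Integration.integrable_add integrable_std_gauss_bounded[of "\<lambda>z. ?J (1 - t) (sqrt t *\<^sub>R z)" B]) auto
      show "(\<integral>w. ?J (1 - (t + h)) (sqrt t *\<^sub>R z + sqrt h *\<^sub>R w) \<partial>std_gauss)
          \<le> ?J (1 - t) (sqrt t *\<^sub>R z) + sqrt h ^ 3 * K" for z
        using K[of "1 - (t + h)" h "sqrt t *\<^sub>R z"] th by (simp add: algebra_simps)
    qed
    also have "\<dots> = M t + sqrt h ^ 3 * K"
    proof -
      have "integrable std_gauss (\<lambda>z. ?J (1 - t) (sqrt t *\<^sub>R z))"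
        using B by (intro integrable_std_gauss_bounded[of _ B]) auto
      then show ?thesis unfolding M_def by simp
    qed
    finally show "M (t + h) \<le> M t + sqrt h ^ 3 * K" .
  qed (use \<tau> in auto)
  then show ?thesis by (simp add: M_def)
qed

text \<open>Continuity makes the smoothed functions converge at the moving points
  \<open>sqrt (1 - \<tau> k) *\<^sub>R x\<close> for every \<open>x\<close>, and the range
  \<open>[c, C]\<close> supplies constant majorants for dominated convergence.\<close>

lemma gauss_ent_inequality_continuous:
  fixes g f :: "'a::euclidean_space \<Rightarrow> real"
  assumes cont: "continuous_on UNIV g" "continuous_on UNIV f"
    and c: "0 < c" and g: "\<And>x. c \<le> g x" "\<And>x. g x \<le> C" and f: "\<And>x. c \<le> f x" "\<And>x. f x \<le> C"
    and r: "0 \<le> r" "r \<le> 1"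
  shows "(\<integral>z. ent_integrand r g f z \<partial>std_gauss) \<le> (\<integral>x. g x \<partial>std_gauss) * ln (\<integral>x. f x \<partial>std_gauss)
     - r\<^sup>2 * ((\<integral>x. g x \<partial>std_gauss) * ln (\<integral>x. g x \<partial>std_gauss))"
proof -
  have [measurable]: "g \<in> borel_measurable borel" "f \<in> borel_measurable borel"
    using cont by (auto intro: borel_measurable_continuous_onI)
  define \<tau> where "\<tau> k = 1 / real (Suc k)" for k
  have \<tau>: "0 < \<tau> k" "\<tau> k \<le> 1" for k by (auto simp: \<tau>_def)
  have \<tau>0: "\<tau> \<longlonglongrightarrow> 0" unfolding \<tau>_def by (rule LIMSEQ_Suc[OF lim_const_over_n])
  let ?s = "\<lambda>k. sqrt (1 - \<tau> k)"
  have conv: "(\<lambda>k. gauss_smooth (\<tau> k) h (?s k *\<^sub>R x)) \<longlonglongrightarrow> h x"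
    if h: "continuous_on UNIV h" "\<And>x. c \<le> h x" "\<And>x. h x \<le> C" for h :: "'a \<Rightarrow> real" and x
  proof -
    have [measurable]: "h \<in> borel_measurable borel"
      using h by (auto intro: borel_measurable_continuous_onI)
    have "(\<lambda>k. \<integral>z. h (?s k *\<^sub>R x + sqrt (\<tau> k) *\<^sub>R z) \<partial>std_gauss) \<longlonglongrightarrow> (\<integral>z. h x \<partial>(std_gauss :: 'a measure))"
    proof (rule integral_dominated_convergence[where w="\<lambda>_. C"])
      show "AE z in std_gauss. (\<lambda>k. h (?s k *\<^sub>R x + sqrt (\<tau> k) *\<^sub>R z)) \<longlonglongrightarrow> h x"
      proof (intro AE_I2)
        fix z :: 'a
        have "(\<lambda>k. ?s k *\<^sub>R x + sqrt (\<tau> k) *\<^sub>R z) \<longlonglongrightarrow> sqrt (1 - 0) *\<^sub>R x + sqrt 0 *\<^sub>R z"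
          by (intro tendsto_intros \<tau>0)
        then have "(\<lambda>k. ?s k *\<^sub>R x + sqrt (\<tau> k) *\<^sub>R z) \<longlonglongrightarrow> x" by simp
        then show "(\<lambda>k. h (?s k *\<^sub>R x + sqrt (\<tau> k) *\<^sub>R z)) \<longlonglongrightarrow> h x"
          by (rule continuous_on_tendsto_compose[OF h(1)]) auto
      qed
      show "AE z in std_gauss. norm (h (?s k *\<^sub>R x + sqrt (\<tau> k) *\<^sub>R z)) \<le> C" for k
        using h c by (intro AE_I2) (simp add: abs_of_nonneg order.trans[OF less_imp_le[OF c]])
    qed auto
    then show ?thesis by (simp add: gauss_smooth_def)
  qed
  obtain B where B: "\<And>\<sigma> z. \<bar>ent_integrand r (gauss_smooth \<sigma> g) (gauss_smooth \<sigma> f) z\<bar> \<le> B"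
  proof -
    have "\<bar>ent_integrand r (gauss_smooth \<sigma> g) (gauss_smooth \<sigma> f) z\<bar> \<le> (1 + r\<^sup>2) * (C * (\<bar>ln c\<bar> + \<bar>ln C\<bar>))" for \<sigma> z
      by (rule ent_integrand_bounded[OF c]; rule gauss_smooth_bounds[OF _ g] gauss_smooth_bounds[OF _ f]; measurable)
    then show ?thesis using that by blast
  qed
  have lim: "(\<lambda>k. \<integral>z. ent_integrand r (gauss_smooth (\<tau> k) g) (gauss_smooth (\<tau> k) f) (?s k *\<^sub>R z) \<partial>std_gauss)
      \<longlonglongrightarrow> (\<integral>z. ent_integrand r g f z \<partial>std_gauss)"
  proof (rule integral_dominated_convergence[where w="\<lambda>_. B"])
    show "AE z in std_gauss. (\<lambda>k. ent_integrand r (gauss_smooth (\<tau> k) g) (gauss_smooth (\<tau> k) f) (?s k *\<^sub>R z))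
        \<longlonglongrightarrow> ent_integrand r g f z"
    proof (intro AE_I2)
      fix z :: "'a \<times> 'a"
      have nz: "g (fst z) \<noteq> 0" "f (correlate r z) \<noteq> 0"
        using c g(1)[of "fst z"] f(1)[of "correlate r z"] by auto
      show "(\<lambda>k. ent_integrand r (gauss_smooth (\<tau> k) g) (gauss_smooth (\<tau> k) f) (?s k *\<^sub>R z))
        \<longlonglongrightarrow> ent_integrand r g f z"
        unfolding ent_integrand_def fst_scaleR correlate_scaleR
        by (intro tendsto_intros conv cont g f nz)
    qed
  qed (use B in auto)
  have "(\<integral>z. ent_integrand r g f z \<partial>std_gauss) \<le> ent_integrand r (gauss_smooth 1 g) (gauss_smooth 1 f) 0"
    by (rule LIMSEQ_le_const2[OF lim])
      (intro exI allI impI ent_integrand_smooth_le[where c=c and C=C]; use c g f r \<tau> in auto)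
  \<comment> \<open>Both arguments vanish at \<open>z = 0\<close>, and \<open>gauss_smooth 1\<close>
    at the origin is the Gaussian mean.\<close>
  then show ?thesis by (simp add: ent_integrand_def gauss_smooth_def)
qed

section \<open>From continuous to measurable functions\<close>

lemma AE_lborel_imp_AE_std_gauss:
  "AE x in lborel. P x \<Longrightarrow> AE x in std_gauss. P x"
  unfolding std_gauss_def by (subst AE_density) auto

text \<open>Clamping an arbitrary continuous approximation to \<open>[c, C]\<close> restores the
  bounds required by the continuous case; the limit is unaffected because \<open>h\<close> already
  takes values there.\<close>

lemma continuous_approximation:
  fixes h :: "'a::euclidean_space \<Rightarrow> real"
  assumes h: "h \<in> borel_measurable borel" "\<And>x. c \<le> h x" "\<And>x. h x \<le> C"
  obtains H where "\<And>n. continuous_on UNIV (H n)" "\<And>n x. c \<le> H n x" "\<And>n x. H n x \<le> C"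
    "AE x in std_gauss. (\<lambda>n. H n x) \<longlonglongrightarrow> h x"
proof -
  have "h \<in> borel_measurable lebesgue"
    using h(1) by (intro measurable_completion) auto
  then have "h measurable_on UNIV"
    by (rule lebesgue_measurable_imp_measurable_on_real) auto
  then obtain N k where N: "negligible N" "\<And>n. continuous_on UNIV (k n)"
      "\<And>x. x \<notin> N \<Longrightarrow> (\<lambda>n. k n x) \<longlonglongrightarrow> h x"
    unfolding measurable_on_def by auto
  show ?thesis
  proof (rule that[of "\<lambda>n x. min C (max c (k n x))"])
    show "continuous_on UNIV (\<lambda>x. min C (max c (k n x)))" for n
      by (intro continuous_intros N)
    show "c \<le> min C (max c (k n x))" for n x
      using h(2,3)[of x] by simp
    show "AE x in std_gauss. (\<lambda>n. min C (max c (k n x))) \<longlonglongrightarrow> h x"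
    proof (rule AE_lborel_imp_AE_std_gauss)
      have "AE x in lebesgue. x \<notin> N"
        using N(1) by (intro AE_not_in) (simp add: negligible_iff_null_sets)
      then have "AE x in lborel. x \<notin> N"
        by (simp add: AE_completion_iff)
      then show "AE x in lborel. (\<lambda>n. min C (max c (k n x))) \<longlonglongrightarrow> h x"
      proof eventually_elim
        case (elim x)
        have "(\<lambda>n. min C (max c (k n x))) \<longlonglongrightarrow> min C (max c (h x))"
          by (intro tendsto_intros N elim)
        then show ?case using h(2,3)[of x] by simp
      qed
    qed
  qed simp
qed

lemma gauss_ent_inequality:
  fixes g f :: "'a::euclidean_space \<Rightarrow> real"
  assumes [measurable]: "g \<in> borel_measurable borel" "f \<in> borel_measurable borel"
    and c: "0 < c" and g: "\<And>x. c \<le> g x" "\<And>x. g x \<le> C" and f: "\<And>x. c \<le> f x" "\<And>x. f x \<le> C"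
    and r: "0 \<le> r" "r \<le> 1"
  shows "(\<integral>z. ent_integrand r g f z \<partial>std_gauss) \<le> (\<integral>x. g x \<partial>std_gauss) * ln (\<integral>x. f x \<partial>std_gauss)
     - r\<^sup>2 * ((\<integral>x. g x \<partial>std_gauss) * ln (\<integral>x. g x \<partial>std_gauss))"
proof -
  obtain G where G: "\<And>n. continuous_on UNIV (G n)" "\<And>n x. c \<le> G n x" "\<And>n x. G n x \<le> C"
    "AE x in std_gauss. (\<lambda>n. G n x) \<longlonglongrightarrow> g x"
    using continuous_approximation[OF assms(1) g] by blast
  obtain F where F: "\<And>n. continuous_on UNIV (F n)" "\<And>n x. c \<le> F n x" "\<And>n x. F n x \<le> C"
    "AE x in std_gauss. (\<lambda>n. F n x) \<longlonglongrightarrow> f x"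
    using continuous_approximation[OF assms(2) f] by blast
  have [measurable]: "G n \<in> borel_measurable borel" "F n \<in> borel_measurable borel" for n
    using G F by (auto intro: borel_measurable_continuous_onI)
  have pos: "0 < (\<integral>x. h x \<partial>std_gauss)"
    if "h \<in> borel_measurable borel" "\<And>x. c \<le> h x" "\<And>x. h x \<le> C" for h :: "'a \<Rightarrow> real"
    using gauss_smooth_bounds(1)[OF that, of 1 0] c by (simp add: gauss_smooth_def)
  \<comment> \<open>The exceptional sets live on one factor and must be pulled back to the product.
    Their preimages under \<open>fst\<close> and \<open>correlate r\<close> are null because both
    maps carry the Gaussian measure to the Gaussian measure.\<close>
  have "AE z in distr std_gauss borel fst. (\<lambda>n. G n z) \<longlonglongrightarrow> g z"
    using G(4) unfolding distr_std_gauss_fst .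
  then have AG: "AE z::'a\<times>'a in std_gauss. (\<lambda>n. G n (fst z)) \<longlonglongrightarrow> g (fst z)"
    by (subst (asm) AE_distr_iff) auto
  have "AE z in distr std_gauss borel (correlate r). (\<lambda>n. F n z) \<longlonglongrightarrow> f z"
    using F(4) unfolding distr_std_gauss_correlate[OF r] .
  then have AF: "AE z in std_gauss. (\<lambda>n. F n (correlate r z)) \<longlonglongrightarrow> f (correlate r z)"
    by (subst (asm) AE_distr_iff) auto
  obtain B where B: "\<And>n z. \<bar>ent_integrand r (G n) (F n) z\<bar> \<le> B"
  proof -
    have "\<bar>ent_integrand r (G n) (F n) z\<bar> \<le> (1 + r\<^sup>2) * (C * (\<bar>ln c\<bar> + \<bar>ln C\<bar>))" for n z
      by (rule ent_integrand_bounded[OF c]) (rule G F)+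
    then show ?thesis using that by blast
  qed
  have lim: "(\<lambda>n. \<integral>z. ent_integrand r (G n) (F n) z \<partial>std_gauss) \<longlonglongrightarrow> (\<integral>z. ent_integrand r g f z \<partial>std_gauss)"
  proof (rule integral_dominated_convergence[where w="\<lambda>_. B"])
    show "AE z in std_gauss. (\<lambda>n. ent_integrand r (G n) (F n) z) \<longlonglongrightarrow> ent_integrand r g f z"
      using AG AF
    proof eventually_elim
      case (elim z)
      have "g (fst z) \<noteq> 0" "f (correlate r z) \<noteq> 0"
        using c g(1)[of "fst z"] f(1)[of "correlate r z"] by auto
      then show ?case unfolding ent_integrand_def by (intro tendsto_intros elim)
    qed
  qed (use B in auto)
  have limh: "(\<lambda>n. \<integral>x. H n x \<partial>std_gauss) \<longlonglongrightarrow> (\<integral>x. h x \<partial>std_gauss)"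
    if "\<And>n. H n \<in> borel_measurable borel" "h \<in> borel_measurable borel" "\<And>n x. c \<le> H n x" "\<And>n x. H n x \<le> C"
      "AE x in std_gauss. (\<lambda>n. H n x) \<longlonglongrightarrow> h x" for H :: "nat \<Rightarrow> 'a \<Rightarrow> real" and h
    using that c by (intro integral_dominated_convergence[where w="\<lambda>_. C"])
      (auto intro!: AE_I2 simp: abs_of_nonneg order.trans[OF less_imp_le[OF c]])
  have gl: "(\<lambda>n. \<integral>x. G n x \<partial>std_gauss) \<longlonglongrightarrow> (\<integral>x. g x \<partial>std_gauss)"
    using G by (intro limh) auto
  have fl: "(\<lambda>n. \<integral>x. F n x \<partial>std_gauss) \<longlonglongrightarrow> (\<integral>x. f x \<partial>std_gauss)"
    using F by (intro limh) auto
  show ?thesis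
  proof (rule LIMSEQ_le[OF lim])
    show "(\<lambda>n. (\<integral>x. G n x \<partial>std_gauss) * ln (\<integral>x. F n x \<partial>std_gauss)
     - r\<^sup>2 * ((\<integral>x. G n x \<partial>std_gauss) * ln (\<integral>x. G n x \<partial>std_gauss)))
      \<longlonglongrightarrow> (\<integral>x. g x \<partial>std_gauss) * ln (\<integral>x. f x \<partial>std_gauss)
     - r\<^sup>2 * ((\<integral>x. g x \<partial>std_gauss) * ln (\<integral>x. g x \<partial>std_gauss))"
      using pos[OF assms(1) g] pos[OF assms(2) f]
      by (intro tendsto_intros gl fl) auto
    show "\<exists>N. \<forall>n\<ge>N. (\<integral>z. ent_integrand r (G n) (F n) z \<partial>std_gauss)
      \<le> (\<integral>x. G n x \<partial>std_gauss) * ln (\<integral>x. F n x \<partial>std_gauss)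
     - r\<^sup>2 * ((\<integral>x. G n x \<partial>std_gauss) * ln (\<integral>x. G n x \<partial>std_gauss))"
      using gauss_ent_inequality_continuous[OF G(1) F(1) c G(2,3) F(2,3) r] by blast
  qed
qed

subsection \<open>Log-subharmonic functions\<close>

lemma continuous_on_matrix_vector_mult:
  "continuous_on UNIV (\<lambda>p :: (real ^ 'n ^ 'm) \<times> (real ^ 'n). fst p *v snd p)"
  unfolding matrix_vector_mult_def
  by (intro continuous_on_vec_lambda continuous_intros)

lemma borel_measurable_matrix_vector_mult:
  "(\<lambda>p :: (real ^ 'n ^ 'm) \<times> (real ^ 'n). fst p *v snd p) \<in> borel \<Otimes>\<^sub>M borel \<rightarrow>\<^sub>M borel"
  unfolding borel_prod by (intro borel_measurable_continuous_onI continuous_on_matrix_vector_mult)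

lemma normalized_haar_O_measurable_ident:
  assumes "normalized_haar_O \<mu>"
  shows "(\<lambda>A. A) \<in> \<mu> \<rightarrow>\<^sub>M borel"
proof -
  have s: "sets \<mu> = sets (restrict_space borel {A. orthogonal_matrix A})"
    using assms by (simp add: normalized_haar_O_def)
  show ?thesis
    unfolding measurable_cong_sets[OF s refl] by (rule measurable_restrict_space1) simp
qed

lemma normalized_haar_O_orthogonal:
  assumes "normalized_haar_O \<mu>" and "A \<in> space \<mu>"
  shows "orthogonal_matrix A"
proof -
  have "sets \<mu> = sets (restrict_space borel {A. orthogonal_matrix A})"
    using assms by (simp add: normalized_haar_O_def)
  from sets_eq_imp_space_eq[OF this] have "space \<mu> = {A. orthogonal_matrix A}"
    by (simp add: space_restrict_space)
  then show ?thesis using assms by simp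
qed

text \<open>Rotation invariance of the Gaussian measure turns an inequality for averages over rotations
  into one for Gaussian averages.\<close>
lemma gauss_submean_if_haar_submean:
  fixes v :: "real ^ 'n \<Rightarrow> ennreal"
  assumes \<mu>: "normalized_haar_O \<mu>" and v [measurable]: "v \<in> borel_measurable borel"
    and sub: "\<And>y. v x \<le> (\<integral>\<^sup>+ A. v (x + A *v y) \<partial>\<mu>)"
  shows "v x \<le> (\<integral>\<^sup>+ z. v (x + t *\<^sub>R z) \<partial>std_gauss)"
proof -
  interpret \<mu>: prob_space \<mu> using \<mu> by (simp add: normalized_haar_O_def)
  interpret pair_sigma_finite \<mu> "std_gauss :: (real ^ 'n) measure" ..
  note [measurable] = normalized_haar_O_measurable_ident[OF \<mu>]
  have [measurable]: "(\<lambda>p. fst p *v (t *\<^sub>R snd p)) \<in> \<mu> \<Otimes>\<^sub>M (std_gauss :: (real ^ 'n) measure) \<rightarrow>\<^sub>M borel"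
  proof -
    have "(\<lambda>p. (fst p, t *\<^sub>R snd p)) \<in> \<mu> \<Otimes>\<^sub>M (std_gauss :: (real ^ 'n) measure) \<rightarrow>\<^sub>M borel \<Otimes>\<^sub>M borel"
      by (intro measurable_Pair measurable_compose[OF measurable_fst normalized_haar_O_measurable_ident[OF \<mu>]]) measurable
    from measurable_compose[OF this borel_measurable_matrix_vector_mult] show ?thesis by simp
  qed
  have m: "(\<lambda>(A, z). v (x + A *v (t *\<^sub>R z))) \<in> borel_measurable (\<mu> \<Otimes>\<^sub>M (std_gauss :: (real ^ 'n) measure))"
    unfolding split_beta by measurable
  have "v x = (\<integral>\<^sup>+ z. v x \<partial>(std_gauss :: (real ^ 'n) measure))" by simp
  \<comment> \<open>The mean value inequality is taken at \<open>y = t *\<^sub>R z\<close> and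
    averaged over Gaussian \<open>z\<close>. After exchanging the integrals, the inner average is
    the same for every \<open>A\<close>.\<close>
  also have "\<dots> \<le> (\<integral>\<^sup>+ z. \<integral>\<^sup>+ A. v (x + A *v (t *\<^sub>R z)) \<partial>\<mu> \<partial>std_gauss)"
    by (intro nn_integral_mono sub)
  also have "\<dots> = (\<integral>\<^sup>+ A. \<integral>\<^sup>+ z. v (x + A *v (t *\<^sub>R z)) \<partial>std_gauss \<partial>\<mu>)"
    by (rule Fubini'[OF m])
  also have "\<dots> = (\<integral>\<^sup>+ A. \<integral>\<^sup>+ z. v (x + t *\<^sub>R z) \<partial>std_gauss \<partial>\<mu>)"
  proof (rule nn_integral_cong)
    fix A assume "A \<in> space \<mu>"
    then have "orthogonal_transformation ((*v) A)"
      using normalized_haar_O_orthogonal[OF \<mu>] by (simp add: orthogonal_transformation_matrix matrix_vector_mul_linear)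
    from nn_integral_std_gauss_orthogonal[OF this, of "\<lambda>z. v (x + t *\<^sub>R z)"]
    show "(\<integral>\<^sup>+ z. v (x + A *v (t *\<^sub>R z)) \<partial>std_gauss) = (\<integral>\<^sup>+ z. v (x + t *\<^sub>R z) \<partial>std_gauss)"
      by (simp add: matrix_vector_mult_scaleR)
  qed
  also have "\<dots> = (\<integral>\<^sup>+ z. v (x + t *\<^sub>R z) \<partial>std_gauss)"
    by (simp add: \<mu>.emeasure_space_1)
  finally show ?thesis .
qed

text \<open>Measurability of the logarithm is part of \<open>locally_integrable\<close>;
  \<open>f\<close> is recovered by exponentiating, with the value 0 at minus infinity.\<close>

lemma log_subharmonic_measurable:
  assumes "log_subharmonic f"
  shows "f \<in> borel_measurable borel"
proof -
  let ?u = "\<lambda>x. if f x = 0 then - \<infinity> else ereal (ln (f x))"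
  have f0: "0 \<le> f x" for x using assms by (simp add: log_subharmonic_def)
  have [measurable]: "?u \<in> borel_measurable borel"
    using assms by (simp add: log_subharmonic_def subharmonic_def locally_integrable_def)
  have "(\<lambda>x. if ?u x = - \<infinity> then 0 else exp (real_of_ereal (?u x))) \<in> borel_measurable borel"
    by measurable
  moreover have "(if ?u x = - \<infinity> then 0 else exp (real_of_ereal (?u x))) = f x" for x
    using f0[of x] by auto
  ultimately show ?thesis by simp
qed

text \<open>Truncation from below is an increasing convex operation and so preserves the mean value
  inequality. Subtracting \<open>ln \<delta>\<close> makes the result nonnegative, hence usable in
  \<open>ennreal\<close>, where integrals may be exchanged freely. The work lies in passing from the
  difference of two integrals in \<open>ereal_integral\<close> to a single one.\<close>

lemma log_subharmonic_haar_submean: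
  fixes f :: "real ^ 'n \<Rightarrow> real"
  assumes f: "log_subharmonic f" and \<delta>: "0 < \<delta>"
  obtains \<mu> where "normalized_haar_O \<mu>"
    "\<And>x y. ennreal (ln (max (f x) \<delta>) - ln \<delta>) \<le> (\<integral>\<^sup>+ A. ennreal (ln (max (f (x + A *v y)) \<delta>) - ln \<delta>) \<partial>\<mu>)"
proof -
  define u where "u x = (if f x = 0 then - \<infinity> else ereal (ln (f x)))" for x
  define M where "M = ln \<delta>"
  define v where "v x = ln (max (f x) \<delta>) - M" for x
  have f0: "0 \<le> f x" for x using f by (simp add: log_subharmonic_def)
  have su: "subharmonic u"
    using f unfolding log_subharmonic_def u_def[abs_def] by simp
  then have um [measurable]: "u \<in> borel_measurable borel"
    by (simp add: subharmonic_def locally_integrable_def)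
  have fm [measurable]: "f \<in> borel_measurable borel" by (rule log_subharmonic_measurable[OF f])
  have vm [measurable]: "v \<in> borel_measurable borel" unfolding v_def by measurable
  obtain \<mu> where \<mu>: "normalized_haar_O \<mu>" and mean: "\<And>x y. u x \<le> ereal_integral \<mu> (\<lambda>A. u (x + A *v y))"
    using su unfolding subharmonic_def by blast
  interpret \<mu>: prob_space \<mu> using \<mu> by (simp add: normalized_haar_O_def)
  have v0: "0 \<le> v x" for x unfolding v_def M_def using \<delta> by simp
  have uv: "u x = - \<infinity> \<or> (u x = ereal (ln (f x)) \<and> v x = max (ln (f x)) M - M)" for x
    using f0[of x] \<delta> by (auto simp: u_def v_def M_def max_def)
  \<comment> \<open>This is \<open>u x - M \<le> v x\<close> with negative parts moved across, so
    that only nonnegative terms are integrated.\<close>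
  have pt1: "e2ennreal (u x) + ennreal (- M) \<le> ennreal (v x) + e2ennreal (- u x) + ennreal M" for x
  proof -
    have "ennreal a + ennreal (- M) \<le> ennreal (max a M - M) + ennreal (- a) + ennreal M" for a
    proof -
      have "ennreal (max 0 a + max 0 (- M)) \<le> ennreal (max 0 (max a M - M) + max 0 (- a) + max 0 M)"
        by (intro ennreal_leI) (simp add: max_def)
      then show ?thesis by (simp only: ennreal_plus ennreal_max_0 max.cobounded1 add_nonneg_nonneg)
    qed
    then show ?thesis using uv[of x] by auto
  qed
  \<comment> \<open>Serves to bound \<open>P\<close> by \<open>V\<close>: the final subtraction of
    integrals requires \<open>P\<close> to be finite.\<close>
  have pt2: "e2ennreal (u x) \<le> ennreal (v x) + ennreal \<bar>M\<bar>" for x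
    using uv[of x] v0[of x]
    by (auto simp: max_def e2ennreal_neg simp flip: ennreal_plus intro!: ennreal_leI split: if_splits)
  have "ennreal (v x) \<le> (\<integral>\<^sup>+ A. ennreal (v (x + A *v y)) \<partial>\<mu>)" for x y
  proof -
    note [measurable] = normalized_haar_O_measurable_ident[OF \<mu>]
    have Am [measurable]: "(\<lambda>A. A *v y) \<in> \<mu> \<rightarrow>\<^sub>M borel"
    proof -
      have "(\<lambda>A. (A, y)) \<in> \<mu> \<rightarrow>\<^sub>M borel \<Otimes>\<^sub>M borel" by measurable
      from measurable_compose[OF this borel_measurable_matrix_vector_mult] show ?thesis by simp
    qed
    define P where "P = (\<integral>\<^sup>+ A. e2ennreal (u (x + A *v y)) \<partial>\<mu>)"
    define N where "N = (\<integral>\<^sup>+ A. e2ennreal (- u (x + A *v y)) \<partial>\<mu>)"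
    define V where "V = (\<integral>\<^sup>+ A. ennreal (v (x + A *v y)) \<partial>\<mu>)"
    have "(\<integral>\<^sup>+ A. e2ennreal (u (x + A *v y)) + ennreal (- M) \<partial>\<mu>)
        \<le> (\<integral>\<^sup>+ A. ennreal (v (x + A *v y)) + e2ennreal (- u (x + A *v y)) + ennreal M \<partial>\<mu>)"
      by (intro nn_integral_mono pt1)
    then have i1: "P + ennreal (- M) \<le> V + N + ennreal M"
      by (simp add: nn_integral_add P_def N_def V_def \<mu>.emeasure_space_1)
    have "(\<integral>\<^sup>+ A. e2ennreal (u (x + A *v y)) \<partial>\<mu>) \<le> (\<integral>\<^sup>+ A. ennreal (v (x + A *v y)) + ennreal \<bar>M\<bar> \<partial>\<mu>)"
      by (intro nn_integral_mono pt2)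
    then have i2: "P \<le> V + ennreal \<bar>M\<bar>"
      by (simp add: nn_integral_add P_def V_def \<mu>.emeasure_space_1)
    have uPN: "u x \<le> enn2ereal P - enn2ereal N"
      using mean[of x y] by (simp add: ereal_integral_def P_def N_def)
    \<comment> \<open>In the first case the right side is infinite or the left side is 0. Otherwise
      \<open>u x\<close> is finite, which rules out \<open>N = \<infinity>\<close>, and the rest is
      real arithmetic.\<close>
    show ?thesis
    proof (cases "V = \<infinity> \<or> f x \<le> \<delta>")
      case True
      then show ?thesis by (auto simp: V_def v_def M_def max_def)
    next
      case False
      then have Vf: "V \<noteq> \<infinity>" and fx: "\<delta> < f x" by auto
      have u: "u x = ereal (ln (f x))" and vx: "v x = ln (f x) - M"
        using fx \<delta> by (auto simp: u_def v_def)
      obtain a where a: "V = ennreal a" "0 \<le> a" using Vf by (cases V) auto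
      have "P \<noteq> \<infinity>" using i2 a by (auto simp: top_unique simp flip: ennreal_plus)
      then obtain p where p: "P = ennreal p" "0 \<le> p" by (cases P) auto
      have "N \<noteq> \<infinity>" using uPN p by (auto simp: u)
      then obtain n where n: "N = ennreal n" "0 \<le> n" by (cases N) auto
      have 1: "ln (f x) \<le> p - n" using uPN p n by (simp add: u)
      have 2: "p - M \<le> a + n"
        using i1 a p n by (cases "0 \<le> M") (auto simp: ennreal_neg simp flip: ennreal_plus)
      show ?thesis
        unfolding V_def[symmetric] a(1) using 1 2 by (intro ennreal_leI) (simp add: vx)
    qed
  qed
  then show ?thesis using \<mu> that unfolding v_def M_def by blast
qed

section \<open>From the entropic inequality to norms\<close>

lemma log_subharmonic_gauss_submean:
  fixes f :: "real ^ 'n \<Rightarrow> real"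
  assumes f: "log_subharmonic f" and \<delta>: "0 < \<delta>"
  shows "ennreal (ln (max (f x) \<delta>) - ln \<delta>)
    \<le> (\<integral>\<^sup>+ z. ennreal (ln (max (f (x + t *\<^sub>R z)) \<delta>) - ln \<delta>) \<partial>std_gauss)"
proof -
  have [measurable]: "f \<in> borel_measurable borel" by (rule log_subharmonic_measurable[OF f])
  obtain \<mu> where "normalized_haar_O \<mu>"
    "\<And>x y. ennreal (ln (max (f x) \<delta>) - ln \<delta>) \<le> (\<integral>\<^sup>+ A. ennreal (ln (max (f (x + A *v y)) \<delta>) - ln \<delta>) \<partial>\<mu>)"
    using log_subharmonic_haar_submean[OF f \<delta>] by blast
  then show ?thesis
    by (intro gauss_submean_if_haar_submean[where v="\<lambda>x. ennreal (ln (max (f x) \<delta>) - ln \<delta>)"]) auto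
qed

text \<open>The offset \<open>b\<close> lets one statement serve two cases: \<open>b = 0\<close>
  with \<open>G\<close> a truncated power of the dilated function, and \<open>r = 0\<close> with
  \<open>G = 1\<close>, where \<open>b\<close> carries the value at the origin. The mean of G(X) (ln
  F(Y) - ln \<delta>) is bounded above by the entropic inequality and below by the mean value
  inequality.\<close>

lemma ln_integral_le:
  fixes f G :: "real ^ 'n \<Rightarrow> real"
  assumes f: "log_subharmonic f" and int: "integrable std_gauss f" and \<delta>: "0 < \<delta>"
    and [measurable]: "G \<in> borel_measurable borel"
    and c: "0 < c" and G: "\<And>x. c \<le> G x" "\<And>x. G x \<le> C"
    and r: "0 \<le> r" "r \<le> 1"
    and le: "\<And>x. b + r\<^sup>2 * ln (G x) \<le> ln (max (f (r *\<^sub>R x)) \<delta>)"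
  shows "b + r\<^sup>2 * ln (\<integral>x. G x \<partial>std_gauss) \<le> ln (\<integral>x. max (f x) \<delta> \<partial>std_gauss)"
proof -
  have fm [measurable]: "f \<in> borel_measurable borel" by (rule log_subharmonic_measurable[OF f])
  define F where "F x = max (f x) \<delta>" for x
  \<comment> \<open>The entropic inequality asks for bounded functions, but a truncation from above
    destroys the mean value inequality. So \<open>Fk\<close> occurs only in the upper bound and is
    removed by monotone convergence before subharmonicity is used.\<close>
  define Fk where "Fk k x = min (F x) (\<delta> + real k)" for k x
  have [measurable]: "F \<in> borel_measurable borel" "Fk k \<in> borel_measurable borel" for k
    unfolding F_def Fk_def by measurable
  have F: "\<delta> \<le> F x" "0 < F x" for x using \<delta> by (auto simp: F_def max_def)
  have Fk: "\<delta> \<le> Fk k x" "Fk k x \<le> \<delta> + real k" "Fk k x \<le> F x" "0 < Fk k x" for k x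
    using F[of x] \<delta> by (auto simp: Fk_def)
  have iF: "integrable std_gauss F" unfolding F_def using int by auto
  have iFk: "integrable std_gauss (Fk k)" for k
    using Fk[of k] F by (intro integrable_std_gauss_bounded[of _ "\<delta> + real k"]) (auto simp: abs_of_pos)
  have iG: "integrable std_gauss G"
    using G c by (intro integrable_std_gauss_bounded[of _ C]) (auto simp: abs_of_nonneg order.trans[OF less_imp_le[OF c]])
  define EG where "EG = (\<integral>x. G x \<partial>std_gauss)"
  define EF where "EF = (\<integral>x. F x \<partial>std_gauss)"
  have EG: "0 < EG"
    using integral_mono[OF std_gauss.integrable_const iG G(1)] c by (simp add: EG_def)
  have EFk: "\<delta> \<le> (\<integral>x. Fk k x \<partial>std_gauss)" "(\<integral>x. Fk k x \<partial>std_gauss) \<le> EF" for k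
    using integral_mono[OF std_gauss.integrable_const iFk Fk(1), of k] integral_mono[OF iFk iF Fk(3), of k]
    by (auto simp: EF_def)
  have EF: "0 < EF" using EFk[of 0] \<delta> by linarith
  have G0: "0 \<le> G x" "0 < G x" for x using c G(1)[of x] by auto
  have lnG: "\<bar>G x * ln (G x)\<bar> \<le> C * (\<bar>ln c\<bar> + \<bar>ln C\<bar>)" for x
    unfolding abs_mult using G[of x] c by (intro mult_mono ln_bounded_interval) auto
  have iGln: "integrable std_gauss (\<lambda>x. G x * ln (G x))"
    using lnG by (intro integrable_std_gauss_bounded) auto
  define H where "H = (\<integral>x. G x * ln (G x) \<partial>std_gauss)"
  \<comment> \<open>The entropic upper bound for the mean of \<open>w k\<close>, with the entropy of
    \<open>G\<close> and the shift by \<open>ln \<delta>\<close> moved to the right; it is the same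
    for all \<open>k\<close>.\<close>
  define X where "X = EG * ln EF - r\<^sup>2 * (EG * ln EG) + r\<^sup>2 * H - ln \<delta> * EG"
  have [measurable]: "(\<lambda>z::(real^'n)\<times>(real^'n). G (fst z)) \<in> borel_measurable borel"
    "(\<lambda>z. Fk k (correlate r z)) \<in> borel_measurable borel"
    "(\<lambda>z. F (correlate r z)) \<in> borel_measurable borel" for k
    by (auto intro!: measurable_compose[OF borel_measurable_fst_Pair] measurable_compose[OF borel_measurable_correlate])
  define w where "w k z = G (fst z) * (ln (Fk k (correlate r z)) - ln \<delta>)" for k z
  have w0: "0 \<le> w k z" for k z
    unfolding w_def using G0 Fk \<delta> by (intro mult_nonneg_nonneg) auto
  have fstint: "(\<integral>z. h (fst z) \<partial>(std_gauss :: ((real^'n)\<times>(real^'n)) measure)) = (\<integral>x. h x \<partial>std_gauss)"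
     "integrable std_gauss h \<Longrightarrow> integrable std_gauss (\<lambda>z::(real^'n)\<times>(real^'n). h (fst z))"
    if [measurable]: "h \<in> borel_measurable borel" for h :: "real ^ 'n \<Rightarrow> real"
  proof -
    have "(\<integral>x. h x \<partial>std_gauss) = (\<integral>x. h x \<partial>distr (std_gauss :: ((real^'n)\<times>(real^'n)) measure) borel fst)"
      by (simp add: distr_std_gauss_fst)
    also have "\<dots> = (\<integral>z. h (fst z) \<partial>(std_gauss :: ((real^'n)\<times>(real^'n)) measure))"
      by (subst integral_distr) auto
    finally show "(\<integral>z. h (fst z) \<partial>(std_gauss :: ((real^'n)\<times>(real^'n)) measure)) = (\<integral>x. h x \<partial>std_gauss)" by simp
    assume "integrable std_gauss h"
    then have "integrable (distr (std_gauss :: ((real^'n)\<times>(real^'n)) measure) borel fst) h"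
      by (simp add: distr_std_gauss_fst)
    then show "integrable std_gauss (\<lambda>z::(real^'n)\<times>(real^'n). h (fst z))"
      by (subst (asm) integrable_distr_eq) auto
  qed
  have wk: "integrable std_gauss (w k)" "(\<integral>z. w k z \<partial>std_gauss) \<le> X" for k
  proof -
    define c' where "c' = min c \<delta>"
    define C' where "C' = max C (\<delta> + real k)"
    have c': "0 < c'" "\<And>x. c' \<le> G x" "\<And>x. G x \<le> C'" "\<And>x. c' \<le> Fk k x" "\<And>x. Fk k x \<le> C'"
      using c \<delta> G Fk unfolding c'_def C'_def by (auto simp: min_le_iff_disj le_max_iff_disj)
    have "(\<integral>z. ent_integrand r G (Fk k) z \<partial>std_gauss)
        \<le> EG * ln (\<integral>x. Fk k x \<partial>std_gauss) - r\<^sup>2 * (EG * ln EG)"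
      unfolding EG_def by (rule gauss_ent_inequality[OF _ _ c' r]) measurable
    also have "\<dots> \<le> EG * ln EF - r\<^sup>2 * (EG * ln EG)"
      using EG EFk[of k] \<delta> by (intro diff_right_mono mult_left_mono ln_mono) linarith+
    finally have ent: "(\<integral>z. ent_integrand r G (Fk k) z \<partial>std_gauss) \<le> EG * ln EF - r\<^sup>2 * (EG * ln EG)" .
    have ie: "integrable std_gauss (ent_integrand r G (Fk k))"
      using ent_integrand_bounded[OF c'(1), of G C' "Fk k" r] c'
      by (intro integrable_std_gauss_bounded) auto
    have weq: "w k = (\<lambda>z. ent_integrand r G (Fk k) z + r\<^sup>2 * (G (fst z) * ln (G (fst z))) - ln \<delta> * G (fst z))"
      by (auto simp: w_def ent_integrand_def algebra_simps)
    show "integrable std_gauss (w k)"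
      unfolding weq using ie fstint(2)[of "\<lambda>x. G x * ln (G x)"] fstint(2)[of G] iG iGln by auto
    have "(\<integral>z. w k z \<partial>std_gauss) = (\<integral>z. ent_integrand r G (Fk k) z \<partial>std_gauss) + r\<^sup>2 * H - ln \<delta> * EG"
      unfolding weq using ie fstint[of "\<lambda>x. G x * ln (G x)"] fstint[of G] iG iGln
      by (simp add: H_def EG_def)
    then show "(\<integral>z. w k z \<partial>std_gauss) \<le> X" using ent by (simp add: X_def)
  qed
  have X0: "0 \<le> X"
  proof -
    have "0 \<le> (\<integral>z. w 0 z \<partial>std_gauss)" by (rule Bochner_Integration.integral_nonneg) (rule w0)
    then show ?thesis using wk(2)[of 0] by linarith
  qed
  have lim: "(\<lambda>k. \<integral>\<^sup>+ z. ennreal (w k z) \<partial>std_gauss)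
      \<longlonglongrightarrow> (\<integral>\<^sup>+ z. ennreal (G (fst z) * (ln (F (correlate r z)) - ln \<delta>)) \<partial>std_gauss)"
  proof (rule nn_integral_LIMSEQ)
    show "incseq (\<lambda>k z. ennreal (w k z))"
    proof (intro incseq_SucI le_funI ennreal_leI)
      show "w k z \<le> w (Suc k) z" for k z
        unfolding w_def using G0[of "fst z"] Fk(4)[of k "correlate r z"] Fk(4)[of "Suc k" "correlate r z"]
        by (intro mult_left_mono diff_right_mono) (auto simp: Fk_def)
    qed
    show "(\<lambda>z. ennreal (w k z)) \<in> borel_measurable std_gauss" for k
      unfolding w_def by measurable
    show "(\<lambda>k. ennreal (w k z)) \<longlonglongrightarrow> ennreal (G (fst z) * (ln (F (correlate r z)) - ln \<delta>))" for z
    proof (rule tendsto_eventually)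
      obtain k0 where "F (correlate r z) \<le> real k0" using real_arch_simple by blast
      then have "Fk k (correlate r z) = F (correlate r z)" if "k0 \<le> k" for k
        using that \<delta> by (auto simp: Fk_def min_def)
      then show "\<forall>\<^sub>F k in sequentially. ennreal (w k z) = ennreal (G (fst z) * (ln (F (correlate r z)) - ln \<delta>))"
        by (intro eventually_sequentiallyI[of k0]) (simp add: w_def)
    qed
  qed
  have up: "(\<integral>\<^sup>+ z. ennreal (G (fst z) * (ln (F (correlate r z)) - ln \<delta>)) \<partial>std_gauss) \<le> ennreal X"
  proof (rule LIMSEQ_le_const2[OF lim])
    have "(\<integral>\<^sup>+ z. ennreal (w k z) \<partial>std_gauss) \<le> ennreal X" for k
      using wk[of k] w0 by (subst nn_integral_eq_integral) (auto intro: ennreal_leI)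
    then show "\<exists>N. \<forall>k\<ge>N. (\<integral>\<^sup>+ z. ennreal (w k z) \<partial>std_gauss) \<le> ennreal X" by blast
  qed
  \<comment> \<open>A real integrable lower bound for the integrand at \<open>r *\<^sub>R x\<close>.
    Comparing only its positive part with the \<open>ennreal\<close> integral is legitimate since
    the larger integrand is nonnegative.\<close>
  define Y where "Y x = G x * (b + r\<^sup>2 * ln (G x) - ln \<delta>)" for x
  have iY: "integrable std_gauss Y"
  proof -
    have "Y = (\<lambda>x. (b - ln \<delta>) * G x + r\<^sup>2 * (G x * ln (G x)))"
      by (auto simp: Y_def algebra_simps)
    then show ?thesis using iG iGln by auto
  qed
  have "(\<integral>\<^sup>+ x. ennreal (max 0 (Y x)) \<partial>std_gauss) \<le> (\<integral>\<^sup>+ x. ennreal (G x) * ennreal (ln (F (r *\<^sub>R x)) - ln \<delta>) \<partial>std_gauss)"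
  proof (rule nn_integral_mono)
    fix x
    have "Y x \<le> G x * (ln (F (r *\<^sub>R x)) - ln \<delta>)"
      unfolding Y_def F_def using le[of x] G0[of x] by (intro mult_left_mono) auto
    moreover have "0 \<le> ln (F (r *\<^sub>R x)) - ln \<delta>" using F[of "r *\<^sub>R x"] \<delta> by simp
    ultimately show "ennreal (max 0 (Y x)) \<le> ennreal (G x) * ennreal (ln (F (r *\<^sub>R x)) - ln \<delta>)"
      using G0[of x] by (simp flip: ennreal_mult add: ennreal_leI)
  qed
  \<comment> \<open>Subharmonicity enters at the point \<open>r *\<^sub>R x\<close> for fixed
    \<open>x\<close>; the scale \<open>sqrt (1 - r\<^sup>2)\<close> turns the displaced point into
    \<open>correlate r (x, y)\<close>.\<close>
  also have "\<dots> \<le> (\<integral>\<^sup>+ x. ennreal (G x) * (\<integral>\<^sup>+ y. ennreal (ln (F (r *\<^sub>R x + sqrt (1 - r\<^sup>2) *\<^sub>R y)) - ln \<delta>) \<partial>std_gauss) \<partial>std_gauss)"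
    unfolding F_def by (intro nn_integral_mono mult_left_mono log_subharmonic_gauss_submean[OF f \<delta>]) auto
  also have "\<dots> = (\<integral>\<^sup>+ z. ennreal (G (fst z) * (ln (F (correlate r z)) - ln \<delta>)) \<partial>std_gauss)"
  proof (subst nn_integral_std_gauss_Pair)
    show "(\<integral>\<^sup>+ x. ennreal (G x) * (\<integral>\<^sup>+ y. ennreal (ln (F (r *\<^sub>R x + sqrt (1 - r\<^sup>2) *\<^sub>R y)) - ln \<delta>) \<partial>std_gauss) \<partial>std_gauss)
      = (\<integral>\<^sup>+ x. \<integral>\<^sup>+ y. ennreal (G (fst (x, y)) * (ln (F (correlate r (x, y))) - ln \<delta>)) \<partial>std_gauss \<partial>std_gauss)"
    proof (rule nn_integral_cong)
      fix x :: "real ^ 'n"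
      have "ln \<delta> \<le> ln (F y)" for y using F[of y] \<delta> by simp
      then show "ennreal (G x) * (\<integral>\<^sup>+ y. ennreal (ln (F (r *\<^sub>R x + sqrt (1 - r\<^sup>2) *\<^sub>R y)) - ln \<delta>) \<partial>std_gauss)
        = (\<integral>\<^sup>+ y. ennreal (G (fst (x, y)) * (ln (F (correlate r (x, y))) - ln \<delta>)) \<partial>std_gauss)"
        using G0[of x] by (subst nn_integral_cmult[symmetric]) (auto simp: correlate_def ennreal_mult)
    qed
  qed measurable
  also note up
  finally have "(\<integral>\<^sup>+ x. ennreal (max 0 (Y x)) \<partial>std_gauss) \<le> ennreal X" .
  then have "ennreal (\<integral>x. max 0 (Y x) \<partial>std_gauss) \<le> ennreal X"
    using iY by (subst (asm) nn_integral_eq_integral) auto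
  then have "(\<integral>x. max 0 (Y x) \<partial>std_gauss) \<le> X" using X0 by simp
  moreover have "(\<integral>x. Y x \<partial>std_gauss) \<le> (\<integral>x. max 0 (Y x) \<partial>std_gauss)"
    using iY by (intro integral_mono) auto
  moreover have "(\<integral>x. Y x \<partial>std_gauss) = (b - ln \<delta>) * EG + r\<^sup>2 * H"
  proof -
    have "Y = (\<lambda>x. (b - ln \<delta>) * G x + r\<^sup>2 * (G x * ln (G x)))"
      by (auto simp: Y_def algebra_simps)
    then show ?thesis using iG iGln by (simp add: EG_def H_def)
  qed
  \<comment> \<open>The terms \<open>r\<^sup>2 * H\<close> and \<open>ln \<delta> * EG\<close> occur
    on both sides and cancel.\<close>
  ultimately have "EG * (b + r\<^sup>2 * ln EG) \<le> EG * ln EF"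
    by (simp add: X_def algebra_simps)
  then show ?thesis
    using EG by (simp add: EG_def EF_def F_def)
qed

text \<open>The exponent \<open>q = 1 / r\<^sup>2\<close> is the largest power of the dilated
  function whose logarithm, weighted by \<open>r\<^sup>2\<close>, stays below
  \<open>ln (F (r *\<^sub>R x))\<close> with offset 0. The summand \<open>\<delta>\<close> is the
  price of \<open>max f \<delta> \<le> f + \<delta>\<close>.\<close>

lemma log_subharmonic_dilation_bound:
  fixes f :: "real ^ 'n \<Rightarrow> real"
  assumes f: "log_subharmonic f" and int: "integrable std_gauss f" and \<delta>: "0 < \<delta>"
    and r: "0 < r" "r \<le> 1"
  shows "(\<integral>\<^sup>+ x. ennreal (f (r *\<^sub>R x) powr (1 / r\<^sup>2)) \<partial>std_gauss)
    \<le> ennreal (((\<integral>x. f x \<partial>std_gauss) + \<delta>) powr (1 / r\<^sup>2))"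
proof -
  have [measurable]: "f \<in> borel_measurable borel" by (rule log_subharmonic_measurable[OF f])
  have f0: "0 \<le> f x" for x using f by (simp add: log_subharmonic_def)
  define q where "q = 1 / r\<^sup>2"
  have q: "0 < q" "r\<^sup>2 * q = 1" using r by (auto simp: q_def)
  define F where "F x = max (f x) \<delta>" for x
  define EF where "EF = (\<integral>x. F x \<partial>std_gauss)"
  have F: "0 < F x" "\<delta> \<le> F x" "f x \<le> F x" "F x \<le> f x + \<delta>" for x
    using \<delta> f0[of x] by (auto simp: F_def)
  have iF: "integrable std_gauss F" unfolding F_def using int by auto
  have [measurable]: "F \<in> borel_measurable borel" unfolding F_def by measurable
  have EF: "0 < EF" "EF \<le> (\<integral>x. f x \<partial>std_gauss) + \<delta>"
    using integral_mono[OF std_gauss.integrable_const iF F(2)] \<delta>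
      integral_mono[OF iF Bochner_Integration.integrable_add[OF int std_gauss.integrable_const] F(4)] int
    by (simp_all add: EF_def)
  \<comment> \<open>Level \<open>Suc k\<close> is at least 1, so
    \<open>min (\<delta> powr q) 1\<close> bounds all \<open>G k\<close> from below.\<close>
  define G where "G k x = min (F (r *\<^sub>R x) powr q) (real (Suc k))" for k x
  define c where "c = min (\<delta> powr q) 1"
  have c: "0 < c" using \<delta> by (simp add: c_def)
  have [measurable]: "G k \<in> borel_measurable borel" for k unfolding G_def by measurable
  have Gc: "c \<le> G k x" "G k x \<le> real (Suc k)" for k x
  proof -
    have "\<delta> powr q \<le> F (r *\<^sub>R x) powr q" using \<delta> q F by (intro powr_mono2) auto
    then show "c \<le> G k x" by (auto simp: c_def G_def)
  qed (simp add: G_def)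
  have iG: "integrable std_gauss (G k)" for k
    using Gc[of k] c by (intro integrable_std_gauss_bounded[of _ "real (Suc k)"])
      (auto simp: abs_of_nonneg order.trans[OF less_imp_le[OF c]] simp del: of_nat_Suc)
  have EG: "(\<integral>x. G k x \<partial>std_gauss) \<le> EF powr q" for k
  proof -
    have pos: "0 < (\<integral>x. G k x \<partial>std_gauss)"
      using integral_mono[OF std_gauss.integrable_const iG Gc(1), of k] c by simp
    have "0 + r\<^sup>2 * ln (\<integral>x. G k x \<partial>std_gauss) \<le> ln (\<integral>x. max (f x) \<delta> \<partial>std_gauss)"
    proof (rule ln_integral_le[OF f int \<delta> _ c Gc])
      show "0 + r\<^sup>2 * ln (G k x) \<le> ln (max (f (r *\<^sub>R x)) \<delta>)" for x
      proof -
        have "ln (G k x) \<le> ln (F (r *\<^sub>R x) powr q)"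
          using c Gc(1)[of k x] by (intro ln_mono) (auto simp: G_def)
        then have "ln (G k x) \<le> q * ln (F (r *\<^sub>R x))" by (simp add: ln_powr)
        then have "r\<^sup>2 * ln (G k x) \<le> r\<^sup>2 * (q * ln (F (r *\<^sub>R x)))" by (intro mult_left_mono) auto
        also have "\<dots> = ln (F (r *\<^sub>R x))" using q(2) by (simp flip: mult.assoc)
        finally show ?thesis by (simp add: F_def)
      qed
    qed (use r in auto)
    then have "r\<^sup>2 * ln (\<integral>x. G k x \<partial>std_gauss) \<le> ln EF" by (simp add: EF_def F_def)
    then have "q * (r\<^sup>2 * ln (\<integral>x. G k x \<partial>std_gauss)) \<le> q * ln EF"
      using q(1) by (intro mult_left_mono) auto
    then have "ln (\<integral>x. G k x \<partial>std_gauss) \<le> ln (EF powr q)"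
      using q(2) EF by (simp add: ln_powr mult.assoc [symmetric] mult.commute [of q])
    then show ?thesis using pos EF by (subst (asm) ln_le_cancel_iff) auto
  qed
  have lim: "(\<lambda>k. \<integral>\<^sup>+ x. ennreal (G k x) \<partial>std_gauss) \<longlonglongrightarrow> (\<integral>\<^sup>+ x. ennreal (F (r *\<^sub>R x) powr q) \<partial>std_gauss)"
  proof (rule nn_integral_LIMSEQ)
    show "incseq (\<lambda>k x. ennreal (G k x))"
      by (intro incseq_SucI le_funI ennreal_leI) (auto simp: G_def)
    show "(\<lambda>k. ennreal (G k x)) \<longlonglongrightarrow> ennreal (F (r *\<^sub>R x) powr q)" for x
    proof (rule tendsto_eventually)
      obtain k0 where "F (r *\<^sub>R x) powr q \<le> real k0" using real_arch_simple by blast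
      then show "\<forall>\<^sub>F k in sequentially. ennreal (G k x) = ennreal (F (r *\<^sub>R x) powr q)"
        by (intro eventually_sequentiallyI[of k0]) (simp add: G_def min_def)
    qed
  qed measurable
  have "(\<integral>\<^sup>+ x. ennreal (f (r *\<^sub>R x) powr q) \<partial>std_gauss) \<le> (\<integral>\<^sup>+ x. ennreal (F (r *\<^sub>R x) powr q) \<partial>std_gauss)"
    using f0 F q by (intro nn_integral_mono ennreal_leI powr_mono2) auto
  also have "\<dots> \<le> ennreal (EF powr q)"
  proof (rule LIMSEQ_le_const2[OF lim])
    have "(\<integral>\<^sup>+ x. ennreal (G k x) \<partial>std_gauss) \<le> ennreal (EF powr q)" for k
      using iG[of k] EG[of k] Gc(1)[of k] c
      by (subst nn_integral_eq_integral) (auto intro!: ennreal_leI AE_I2 order.trans[OF less_imp_le[OF c]])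
    then show "\<exists>N. \<forall>k\<ge>N. (\<integral>\<^sup>+ x. ennreal (G k x) \<partial>std_gauss) \<le> ennreal (EF powr q)" by blast
  qed
  also have "\<dots> \<le> ennreal (((\<integral>x. f x \<partial>std_gauss) + \<delta>) powr q)"
    using EF q by (intro ennreal_leI powr_mono2) auto
  finally show ?thesis by (simp add: q_def)
qed

text \<open>For \<open>r = 0\<close> only the second component remains in \<open>correlate\<close>,
  and with the test function 1 the entropic inequality is Jensen's inequality for \<open>ln\<close>.
  The origin enters through the offset \<open>ln (max (f 0) \<delta>)\<close>.\<close>

lemma log_subharmonic_origin_bound:
  fixes f :: "real ^ 'n \<Rightarrow> real"
  assumes f: "log_subharmonic f" and int: "integrable std_gauss f" and \<delta>: "0 < \<delta>"
  shows "f 0 \<le> (\<integral>x. f x \<partial>std_gauss) + \<delta>"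
proof -
  have [measurable]: "f \<in> borel_measurable borel" by (rule log_subharmonic_measurable[OF f])
  have f0: "0 \<le> f x" for x using f by (simp add: log_subharmonic_def)
  let ?F = "\<lambda>x. max (f x) \<delta>"
  have iF: "integrable std_gauss ?F" using int by auto
  have EF: "0 < (\<integral>x. ?F x \<partial>std_gauss)"
    using integral_mono[OF std_gauss.integrable_const iF, of \<delta>] \<delta> by simp
  have "ln (?F 0) + 0\<^sup>2 * ln (\<integral>x. 1 \<partial>(std_gauss :: (real ^ 'n) measure)) \<le> ln (\<integral>x. ?F x \<partial>std_gauss)"
    by (rule ln_integral_le[OF f int \<delta>, where c=1 and C=1]) auto
  then have "?F 0 \<le> (\<integral>x. ?F x \<partial>std_gauss)"
    using EF \<delta> by simp
  also have "\<dots> \<le> (\<integral>x. f x + \<delta> \<partial>std_gauss)"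
    using iF int f0 \<delta> by (intro integral_mono) auto
  also have "\<dots> = (\<integral>x. f x \<partial>std_gauss) + \<delta>" using int by simp
  finally show ?thesis by simp
qed

theorem theorem3p2:
  fixes f :: "real ^ 'n \<Rightarrow> real" and r :: real
  assumes "log_subharmonic f"
    and "0 \<le> r" and "r \<le> 1"
  shows "Lp_norm (if r = 0 then \<infinity> else ennreal (1 / r\<^sup>2)) gaussian (\<lambda>x. f (r *\<^sub>R x))
       \<le> Lp_norm 1 gaussian f"
proof -
  note f = assms(1)
  have [measurable]: "f \<in> borel_measurable borel" by (rule log_subharmonic_measurable[OF f])
  have f0: "0 \<le> f x" for x using f by (simp add: log_subharmonic_def)
  have abs_f: "\<bar>f x\<bar> = f x" for x using f0[of x] by simp
  let ?I = "\<integral>\<^sup>+ x. ennreal (f x) \<partial>std_gauss"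
  show ?thesis
  proof (cases "?I = \<infinity>")
    case True
    then show ?thesis
      by (simp add: Lp_norm_def gaussian_eq_std_gauss abs_f powr_one[OF f0])
  next
    case False
    then have int: "integrable std_gauss f"
      using f0 by (intro integrableI_nonneg) (auto simp: less_top)
    define E where "E = (\<integral>x. f x \<partial>std_gauss)"
    have E0: "0 \<le> E" unfolding E_def by (rule Bochner_Integration.integral_nonneg) (rule f0)
    have I: "?I = ennreal E"
      unfolding E_def using int f0 by (intro nn_integral_eq_integral) auto
    have rhs: "Lp_norm 1 gaussian f = ennreal E"
      using E0 by (simp add: Lp_norm_def gaussian_eq_std_gauss abs_f powr_one[OF f0] I)
    show ?thesis
    proof (cases "r = 0")
      case True
      have "f 0 \<le> E"
        by (rule field_le_epsilon) (use log_subharmonic_origin_bound[OF f int] in \<open>simp add: E_def\<close>)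
      then have "esssup gaussian (\<lambda>x::real ^ 'n. ennreal \<bar>f 0\<bar>) \<le> ennreal E"
        by (intro esssup_I) (auto simp: abs_f ennreal_leI)
      then show ?thesis using True by (simp add: rhs) (simp add: Lp_norm_def)
    next
      case False
      define q where "q = 1 / r\<^sup>2"
      have r: "0 < r" using False assms by simp
      have q: "0 < q" using r by (simp add: q_def)
      let ?J = "\<integral>\<^sup>+ x. ennreal (f (r *\<^sub>R x) powr q) \<partial>std_gauss"
      \<comment> \<open>The perturbation \<open>\<delta> = 1 / real (Suc n)\<close> is sent to 0;
        since \<open>q\<close> is positive, the limit is also correct when
        \<open>E = 0\<close>.\<close>
      have "?J \<le> ennreal (E powr q)"
      proof (rule LIMSEQ_le_const)
        have "(\<lambda>n. (E + 1 / real (Suc n)) powr q) \<longlonglongrightarrow> (E + 0) powr q"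
        proof (rule tendsto_powr')
          show "(\<lambda>n. E + 1 / real (Suc n)) \<longlonglongrightarrow> E + 0"
            by (intro tendsto_intros LIMSEQ_Suc[OF lim_const_over_n])
        qed (use q E0 in auto)
        then show "(\<lambda>n. ennreal ((E + 1 / real (Suc n)) powr q)) \<longlonglongrightarrow> ennreal (E powr q)"
          by (intro tendsto_ennrealI) simp
        show "\<exists>N. \<forall>n\<ge>N. ?J \<le> ennreal ((E + 1 / real (Suc n)) powr q)"
          using log_subharmonic_dilation_bound[OF f int _ r assms(3)] by (auto simp: E_def q_def)
      qed
      then obtain j where j: "?J = ennreal j" "0 \<le> j" "j \<le> E powr q"
        by (cases ?J) (auto simp: top_unique)
      have "j powr (1 / q) \<le> (E powr q) powr (1 / q)"
        using j q by (intro powr_mono2) auto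
      also have "\<dots> = E" using q E0 by (simp add: powr_powr)
      finally have "ennreal (j powr (1 / q)) \<le> ennreal E" by (rule ennreal_leI)
      moreover have "Lp_norm (ennreal q) gaussian (\<lambda>x. f (r *\<^sub>R x)) = ennreal (j powr (1 / q))"
        using q j by (simp add: Lp_norm_def gaussian_eq_std_gauss abs_f)
      ultimately show ?thesis using False by (simp add: rhs q_def)
    qed
  qed
qed

end
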